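(* Let $\mathcal{X}$ be a compact subset of $\mathbb{R}^{Jd}$, let $M$ be a Borel probability distribution on $\mathcal{X}$, let $G_0\in\mathbb{P}$, and let $\Pi$ be a prior (a probability distribution) on $\mathbb{P}$ with prior predictive distribution $H$, such that $G_0$ lies in the weak support of $\Pi$. Suppose that (i) $P_0(\{j\}\mid \mathbf{x}):=q_j(\mathbf{x};G_0)>0$ for every $j\in\{1,\dots,J\}$ and every $\mathbf{x}\in\mathcal{X}$; (ii) $\int_{\mathbb{R}^d}|\boldsymbol\beta|\,H(\mathrm{d}\boldsymbol\beta)<+\infty$. Then $\Pi$ is consistent at $G_0$, i.e. for every $\epsilon>0$, $\Pi_n\{G\in\mathbb{P}: d(\mathbf{q}(\cdot;G),\mathbf{q}(\cdot;G_0))>\epsilon\}\to 0$ almost surely under $\mathrm{P}^\infty_{(G_0,M)}$ as $n\to\infty$.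
   Context: Fix integers $J\ge 2$ and $d\ge1$, and let $\mathbf{C}=\{1,\dots,J\}$. Write $\mathbf{x}=(\mathbf{x}_1,\dots,\mathbf{x}_J)\in\mathbb{R}^{Jd}$ with $\mathbf{x}_j\in\mathbb{R}^d$. The multinomial logit kernels are $k_j(\mathbf{x},\boldsymbol\beta)=\exp(\mathbf{x}_j'\boldsymbol\beta)/\sum_{l\in\mathbf{C}}\exp(\mathbf{x}_l'\boldsymbol\beta)$ for $j\in\mathbf{C}$, $\boldsymbol\beta\in\mathbb{R}^d$. $\mathbb{P}$ denotes the space of Borel probability measures on $\mathbb{R}^d$ with the weak topology. For $G\in\mathbb{P}$, $q_j(\mathbf{x};G)=\int_{\mathbb{R}^d}k_j(\mathbf{x},\boldsymbol\beta)G(\mathrm{d}\boldsymbol\beta)$ and $\mathbf{q}(\mathbf{x};G)=(q_1(\mathbf{x};G),\dots,q_J(\mathbf{x};G))$, a point of the probability simplex in $\mathbb{R}^J$. The distance $d(\mathbf{q}_1,\mathbf{q}_2)=\int_{\mathcal{X}}|\mathbf{q}_1(\mathbf{x})-\mathbf{q}_2(\mathbf{x})|\,M(\mathrm{d}\mathbf{x})$, with $|\cdot|$ the Euclidean norm. The prior predictive distribution of $\Pi$ is $H(B)=\int_{\mathbb{P}}G(B)\,\Pi(\mathrm{d}G)$ for Borel $B\subset\mathbb{R}^d$. $G_0$ is in the weak support of $\Pi$ if every weak neighborhood of $G_0$ has positive $\Pi$-probability. Data: $(Y_i,\mathbf{X}_i)_{i\ge1}$ are i.i.d. with $\mathbf{X}_i\sim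 M$ and $\mathrm{P}(Y_i=j\mid\mathbf{X}_i=\mathbf{x})=q_j(\mathbf{x};G_0)$; their joint law is $\mathrm{P}^\infty_{(G_0,M)}$. With $\Lambda_n(G)=\prod_{i=1}^n q_{Y_i}(\mathbf{X}_i;G)/q_{Y_i}(\mathbf{X}_i;G_0)$, the posterior is $\Pi_n(A)=\int_A\Lambda_n(G)\Pi(\mathrm{d}G)/\int_{\mathbb{P}}\Lambda_n(G)\Pi(\mathrm{d}G)$. *)

theory Defs
  imports "HOL-Probability.Probability"
begin

text \<open>Choice set C = UNIV of a finite type 'c (CARD('c) = J); covariates
  x = (x_j)_j in (R^d)^C = R^{Jd}; coefficients beta in R^d.\<close>

definition mnl_kernel :: "'c::finite \<Rightarrow> (real^'d)^'c \<Rightarrow> real^'d \<Rightarrow> real" where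
  "mnl_kernel j x \<beta> = exp ((x $ j) \<bullet> \<beta>) / (\<Sum>l\<in>UNIV. exp ((x $ l) \<bullet> \<beta>))"

definition mixq :: "'c::finite \<Rightarrow> (real^'d)^'c \<Rightarrow> (real^'d) measure \<Rightarrow> real" where
  "mixq j x G = (\<integral>\<beta>. mnl_kernel j x \<beta> \<partial>G)"

definition mixq_vec :: "(real^'d)^'c \<Rightarrow> (real^'d) measure \<Rightarrow> real^'c::finite" where
  "mixq_vec x G = (\<chi> j. mixq j x G)"

definition qdist :: "((real^'d)^'c::finite) measure \<Rightarrow> (real^'d) measure \<Rightarrow> (real^'d) measure \<Rightarrow> real" where
  "qdist M G1 G2 = (\<integral>x. norm (mixq_vec x G1 - mixq_vec x G2) \<partial>M)"

abbreviation PBorel :: "(real^'d) measure set" where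
  "PBorel \<equiv> space (prob_algebra (borel :: (real^'d) measure))"

definition weak_topology :: "(real^'d) measure topology" where
  "weak_topology = topology_generated_by
     {{G \<in> PBorel. (\<integral>\<beta>. f \<beta> \<partial>G) \<in> U} | (f :: real^'d \<Rightarrow> real) U.
        continuous_on UNIV f \<and> bounded (range f) \<and> open U}"

definition in_weak_support :: "(real^'d) measure measure \<Rightarrow> (real^'d) measure \<Rightarrow> bool" where
  "in_weak_support Prior G0 \<longleftrightarrow>
     (\<forall>U. openin weak_topology U \<and> G0 \<in> U \<longrightarrow> emeasure Prior U > 0)"

definition prior_predictive :: "(real^'d) measure measure \<Rightarrow> (real^'d) measure" where
  "prior_predictive Prior = Prior \<bind> (\<lambda>G. G)"

text \<open>Law of one observation (Y, X): X ~ M, P(Y = j | X = x) = q_j(x; G0).\<close>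
definition obs_law :: "((real^'d)^'c::finite) measure \<Rightarrow> (real^'d) measure \<Rightarrow> ('c \<times> ((real^'d)^'c)) measure" where
  "obs_law M G0 = density (count_space UNIV \<Otimes>\<^sub>M M) (\<lambda>(y, x). ennreal (mixq y x G0))"

definition data_law :: "((real^'d)^'c::finite) measure \<Rightarrow> (real^'d) measure \<Rightarrow> (nat \<Rightarrow> 'c \<times> ((real^'d)^'c)) measure" where
  "data_law M G0 = (\<Pi>\<^sub>M i\<in>(UNIV::nat set). obs_law M G0)"

definition lik_ratio :: "(real^'d) measure \<Rightarrow> nat \<Rightarrow> (nat \<Rightarrow> 'c::finite \<times> ((real^'d)^'c)) \<Rightarrow> (real^'d) measure \<Rightarrow> real" where
  "lik_ratio G0 n \<omega> G = (\<Prod>i<n. mixq (fst (\<omega> i)) (snd (\<omega> i)) G / mixq (fst (\<omega> i)) (snd (\<omega> i)) G0)"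

definition posterior :: "(real^'d) measure measure \<Rightarrow> (real^'d) measure \<Rightarrow> nat \<Rightarrow> (nat \<Rightarrow> 'c::finite \<times> ((real^'d)^'c)) \<Rightarrow> (real^'d) measure set \<Rightarrow> real" where
  "posterior Prior G0 n \<omega> A =
     (\<integral>G. indicator A G * lik_ratio G0 n \<omega> G \<partial>Prior) / (\<integral>G. lik_ratio G0 n \<omega> G \<partial>Prior)"

end

theory Submission
  imports Defs
begin

text \<open>
  Along a suitable subsequence of any coefficient sequence, every linear functional converges in
  \<open>[-\<infinity>, \<infinity>]\<close>, so the logit kernels converge pointwise. The kernels, and with them the
  choice probabilities \<open>q(\<cdot>; G)\<close> over all mixing distributions \<open>G\<close>, are therefore totally bounded
  in \<open>L\<^sup>1(M)\<close>. Hence the alternatives at distance more than \<open>\<epsilon>\<close> from \<open>G0\<close> are separated from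
  it by finitely many bounded test functions, which makes the integrated likelihood ratio over them
  almost surely smaller than \<open>\<rho> ^ n\<close> for some \<open>\<rho> < 1\<close>. On the other hand, on a weak neighbourhood
  of \<open>G0\<close> each likelihood factor is at least \<open>\<kappa>\<close>, uniformly on the compact covariate set, for any
  \<open>\<kappa> < 1\<close>; taking \<open>\<rho> < \<kappa>\<close> the posterior mass decays like \<open>(\<rho> / \<kappa>) ^ n\<close>.
\<close>

subsection \<open>Integrated likelihood ratios of i.i.d. data\<close>

text \<open>Two obstacles shape the argument. The space of mixing distributions is not compact:
  coefficients may escape to infinity, and the kernels can then tend to functions that jump in the
  covariates, such as the indicator that one utility \<open>x $ j \<bullet> \<theta>\<close> exceeds
  all others. A finite net in the uniform norm need not exist, whereas pointwise limits do, and
  dominated convergence makes them limits in mean. As the net covers all mixing distributions at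
  once, a single rate \<rho> serves every alternative. The other obstacle is to turn separation into
  exponential decay. In place of a test with error probabilities, each net point gets a positive
  weight \<open>w\<close> on observations such that \<open>1 / w\<close> has mean at most \<rho>
  under \<open>G0\<close> and \<open>w\<close> has mean at most \<rho> under every \<open>G\<close>
  near the net point. By independence, products of weights over the data have means bounded by
  \<open>\<rho> ^ n\<close>. The value \<open>\<rho> = 1 - \<epsilon>\<^sup>2 / 1152\<close> comes
  from expanding \<open>1 / w\<close> to second order.\<close>

lemma nn_integral_PiM_prod_coordinates:
  assumes "prob_space P" and [measurable]: "f \<in> borel_measurable P"
  shows "(\<integral>\<^sup>+\<omega>. (\<Prod>i<n. f (\<omega> i)) \<partial>(\<Pi>\<^sub>M i\<in>(UNIV::nat set). P)) = (\<integral>\<^sup>+z. f z \<partial>P) ^ n"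
proof -
  interpret P: prob_space P by fact
  interpret PP: product_prob_space "\<lambda>_::nat. P" UNIV ..
  \<comment> \<open>The integrand reads only the first \<open>n\<close> coordinates, so the infinite
    product may be projected to a finite one, where the integral factorises.\<close>
  have eq: "distr (\<Pi>\<^sub>M i\<in>UNIV. P) (\<Pi>\<^sub>M i\<in>{..<n}. P) (\<lambda>\<omega>. restrict \<omega> {..<n}) = (\<Pi>\<^sub>M i\<in>{..<n}. P)"
    by (intro PP.distr_PiM_restrict_finite) auto
  have "(\<integral>\<^sup>+\<omega>. (\<Prod>i<n. f (\<omega> i)) \<partial>(\<Pi>\<^sub>M i\<in>(UNIV::nat set). P)) =
        (\<integral>\<^sup>+\<omega>. (\<Prod>i<n. f (\<omega> i)) \<partial>distr (\<Pi>\<^sub>M i\<in>UNIV. P) (\<Pi>\<^sub>M i\<in>{..<n}. P) (\<lambda>\<omega>. restrict \<omega> {..<n}))"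
    by (subst nn_integral_distr) (auto intro!: nn_integral_cong prod.cong)
  also have "\<dots> = (\<integral>\<^sup>+z. f z \<partial>P) ^ n"
    unfolding eq by (subst PP.product_nn_integral_prod) auto
  finally show ?thesis .
qed

text \<open>The series of the terms \<open>(1/s) ^ n * f n\<close> has integral at most the
  geometric sum of \<open>s ^ n\<close>. It is therefore finite almost everywhere, so its terms drop
  below 1. The square in the hypothesis pays for both the weight and the convergence of the
  series.\<close>

lemma AE_eventually_le_power:
  fixes f :: "nat \<Rightarrow> 'a \<Rightarrow> ennreal" and s :: real
  assumes [measurable]: "\<And>n. f n \<in> borel_measurable N"
    and s: "0 < s" "s < 1" and bound: "\<And>n. (\<integral>\<^sup>+\<omega>. f n \<omega> \<partial>N) \<le> ennreal (s\<^sup>2) ^ n"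
  shows "AE \<omega> in N. \<forall>\<^sub>F n in sequentially. f n \<omega> \<le> ennreal (s ^ n)"
proof -
  have "(\<integral>\<^sup>+\<omega>. (\<Sum>n. ennreal ((1/s) ^ n) * f n \<omega>) \<partial>N) = (\<Sum>n. ennreal ((1/s) ^ n) * (\<integral>\<^sup>+\<omega>. f n \<omega> \<partial>N))"
    by (simp add: nn_integral_suminf nn_integral_cmult)
  also have "\<dots> \<le> (\<Sum>n. ennreal (s ^ n))"
  proof (intro suminf_le allI)
    fix n
    have "ennreal ((1/s) ^ n) * (\<integral>\<^sup>+\<omega>. f n \<omega> \<partial>N) \<le> ennreal ((1/s) ^ n) * ennreal (s\<^sup>2) ^ n"
      by (intro mult_left_mono bound) auto
    also have "\<dots> = ennreal ((1/s) ^ n * (s\<^sup>2) ^ n)"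
      using s by (subst ennreal_mult) (auto simp: ennreal_power)
    also have "(1/s) ^ n * (s\<^sup>2) ^ n = (1/s * s\<^sup>2) ^ n" by (rule power_mult_distrib[symmetric])
    also have "1/s * s\<^sup>2 = s" using s by (simp add: power2_eq_square)
    finally show "ennreal ((1/s) ^ n) * (\<integral>\<^sup>+\<omega>. f n \<omega> \<partial>N) \<le> ennreal (s ^ n)" .
  qed auto
  also have "\<dots> = ennreal (\<Sum>n. s ^ n)"
    using s by (intro suminf_ennreal2) (auto intro!: summable_geometric)
  also have "\<dots> < \<infinity>" by simp
  finally have "AE \<omega> in N. (\<Sum>n. ennreal ((1/s) ^ n) * f n \<omega>) \<noteq> \<infinity>"
    by (intro nn_integral_PInf_AE) auto
  then show ?thesis
  proof eventually_elim
    case (elim \<omega>)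
    have "(\<lambda>n. ennreal ((1/s) ^ n) * f n \<omega>) \<longlonglongrightarrow> 0"
    proof -
      have "ennreal ((1/s) ^ n) * f n \<omega> \<noteq> \<top>" for n
        using elim ennreal_suminf_lessD[of "\<lambda>n. ennreal ((1/s) ^ n) * f n \<omega>" \<top> n]
        by (auto simp: less_top)
      \<comment> \<open>Finite terms can be read as a real sequence, for which summability implies
        convergence to zero.\<close>
      moreover define y where "y n = enn2real (ennreal ((1/s) ^ n) * f n \<omega>)" for n
      ultimately have y: "0 \<le> y n" "ennreal ((1/s) ^ n) * f n \<omega> = ennreal (y n)" for n
        by (simp_all add: less_top)
      have "summable y"
        using elim y by (intro summable_suminf_not_top) auto
      then show ?thesis
        unfolding y(2) using tendsto_ennrealI[OF summable_LIMSEQ_zero] by fastforce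
    qed
    then have "\<forall>\<^sub>F n in sequentially. ennreal ((1/s) ^ n) * f n \<omega> < 1"
      by (rule order_tendstoD) simp
    then show ?case
    proof eventually_elim
      case (elim n)
      have "ennreal (s ^ n) * ennreal ((1/s) ^ n) = ennreal (s ^ n * (1/s) ^ n)"
        using s by (intro ennreal_mult[symmetric]) auto
      also have "s ^ n * (1/s) ^ n = 1"
        using s by (subst power_mult_distrib[symmetric]) simp
      finally have "f n \<omega> = ennreal (s ^ n) * (ennreal ((1/s) ^ n) * f n \<omega>)"
        by (subst mult.assoc[symmetric]) simp
      also have "\<dots> \<le> ennreal (s ^ n) * 1"
        using elim by (intro mult_left_mono) auto
      finally show ?case by simp
    qed
  qed
qed

text \<open>The left-hand integral is the product of its \<open>\<Prod>w\<close>-weighted version and \<open>\<Prod>1/w\<close>, whose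
  expectations are both at most \<open>\<rho> ^ n\<close>.\<close>
lemma AE_eventually_integrated_lik_le_power:
  fixes r :: "'z \<Rightarrow> 'g \<Rightarrow> ennreal" and w :: "'z \<Rightarrow> real"
  assumes "prob_space P" "prob_space Q"
    and [measurable]: "(\<lambda>(z, g). r z g) \<in> borel_measurable (P \<Otimes>\<^sub>M Q)" "w \<in> borel_measurable P"
    and w_pos: "\<And>z. w z > 0" and \<rho>: "0 < \<rho>" "\<rho> < 1"
    and inv: "(\<integral>\<^sup>+z. ennreal (1 / w z) \<partial>P) \<le> ennreal \<rho>"
  shows "AE \<omega> in (\<Pi>\<^sub>M i\<in>(UNIV::nat set). P). \<forall>\<^sub>F n in sequentially.
     (\<integral>\<^sup>+g. indicator {g \<in> space Q. (\<integral>\<^sup>+z. r z g * ennreal (w z) \<partial>P) \<le> ennreal \<rho>} g *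
        (\<Prod>i<n. r (\<omega> i) g) \<partial>Q) \<le> ennreal (\<rho> ^ n)"
proof -
  interpret P: prob_space P by fact
  interpret Q: prob_space Q by fact
  interpret PP: product_prob_space "\<lambda>_::nat. P" UNIV ..
  let ?N = "\<Pi>\<^sub>M i\<in>(UNIV::nat set). P"
  interpret N: prob_space ?N by (intro prob_space_PiM P.prob_space_axioms)
  interpret NQ: pair_sigma_finite ?N Q ..
  define B where "B = {g \<in> space Q. (\<integral>\<^sup>+z. r z g * ennreal (w z) \<partial>P) \<le> ennreal \<rho>}"
  have [measurable]: "(\<lambda>(g, z). r z g) \<in> borel_measurable (Q \<Otimes>\<^sub>M P)"
    using measurable_compose[OF measurable_pair_swap' assms(3)] by (simp add: case_prod_unfold)
  have [measurable]: "B \<in> sets Q" unfolding B_def by measurable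
  have [measurable]: "(\<lambda>(\<omega>, g). r (\<omega> i) g) \<in> borel_measurable (?N \<Otimes>\<^sub>M Q)" for i
    using measurable_compose[of "\<lambda>p. (fst p i, snd p)", OF _ assms(3)] by (simp add: case_prod_unfold)
  define L where "L n \<omega> = (\<integral>\<^sup>+g. indicator B g * (\<Prod>i<n. r (\<omega> i) g) \<partial>Q)" for n and \<omega> :: "nat \<Rightarrow> 'z"
  have [measurable]: "L n \<in> borel_measurable ?N" for n
    unfolding L_def by measurable
  \<comment> \<open>Both factors below have mean at most
    \<open>\<rho> ^ n = (s\<^sup>2) ^ n\<close>, so each is eventually at most \<open>s ^ n\<close>,
    and their product recovers \<open>\<rho> ^ n\<close> without loss.\<close>
  define s where "s = sqrt \<rho>"
  have s: "0 < s" "s < 1" "s\<^sup>2 = \<rho>" using \<rho> by (auto simp: s_def)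
  define a where "a n \<omega> = L n \<omega> * (\<Prod>i<n. ennreal (w (\<omega> i)))" for n \<omega>
  define b where "b n \<omega> = (\<Prod>i<n. ennreal (1 / w (\<omega> i)))" for n and \<omega> :: "nat \<Rightarrow> 'z"
  have [measurable]: "a n \<in> borel_measurable ?N" "b n \<in> borel_measurable ?N" for n
    unfolding a_def b_def by measurable
  have r_meas: "(\<lambda>z. r z g) \<in> borel_measurable P" if "g \<in> space Q" for g
    using measurable_Pair1[OF assms(3) that] by simp
  have "(\<integral>\<^sup>+\<omega>. a n \<omega> \<partial>?N) \<le> ennreal \<rho> ^ n" for n
  proof -
    have "(\<integral>\<^sup>+\<omega>. a n \<omega> \<partial>?N) = (\<integral>\<^sup>+\<omega>. \<integral>\<^sup>+g. indicator B g * (\<Prod>i<n. r (\<omega> i) g * ennreal (w (\<omega> i))) \<partial>Q \<partial>?N)"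
      unfolding a_def L_def by (intro nn_integral_cong)
        (subst nn_integral_multc[symmetric], measurable, simp add: prod.distrib mult.assoc)
    \<comment> \<open>Tonelli lets the data be averaged first with \<open>g\<close> fixed;
      membership of \<open>g\<close> in \<open>B\<close> is exactly the bound needed on each
      coordinate.\<close>
    also have "\<dots> = (\<integral>\<^sup>+g. \<integral>\<^sup>+\<omega>. indicator B g * (\<Prod>i<n. r (\<omega> i) g * ennreal (w (\<omega> i))) \<partial>?N \<partial>Q)"
      by (rule NQ.Fubini'[symmetric]) measurable
    also have "\<dots> \<le> (\<integral>\<^sup>+g. ennreal \<rho> ^ n \<partial>Q)"
    proof (rule nn_integral_mono)
      fix g assume g: "g \<in> space Q"
      note r_meas[OF g, measurable]
      have "(\<integral>\<^sup>+\<omega>. indicator B g * (\<Prod>i<n. r (\<omega> i) g * ennreal (w (\<omega> i))) \<partial>?N) =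
          indicator B g * (\<integral>\<^sup>+z. r z g * ennreal (w z) \<partial>P) ^ n"
        by (subst nn_integral_cmult, measurable)
           (subst nn_integral_PiM_prod_coordinates[OF \<open>prob_space P\<close>, where f="\<lambda>z. r z g * ennreal (w z)"], auto)
      also have "\<dots> \<le> ennreal \<rho> ^ n"
        by (auto simp: indicator_def B_def intro!: power_mono)
      finally show "(\<integral>\<^sup>+\<omega>. indicator B g * (\<Prod>i<n. r (\<omega> i) g * ennreal (w (\<omega> i))) \<partial>?N) \<le> ennreal \<rho> ^ n" .
    qed
    also have "\<dots> = ennreal \<rho> ^ n" by (simp add: Q.emeasure_space_1)
    finally show ?thesis .
  qed
  then have "AE \<omega> in ?N. \<forall>\<^sub>F n in sequentially. a n \<omega> \<le> ennreal (s ^ n)"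
    using s by (intro AE_eventually_le_power) auto
  moreover have "(\<integral>\<^sup>+\<omega>. b n \<omega> \<partial>?N) \<le> ennreal \<rho> ^ n" for n
    unfolding b_def using inv
    by (subst nn_integral_PiM_prod_coordinates[OF \<open>prob_space P\<close>, where f="\<lambda>z. ennreal (1 / w z)"])
       (auto intro!: power_mono)
  then have "AE \<omega> in ?N. \<forall>\<^sub>F n in sequentially. b n \<omega> \<le> ennreal (s ^ n)"
    using s by (intro AE_eventually_le_power) auto
  ultimately show ?thesis
    unfolding B_def[symmetric]
  proof eventually_elim
    case (elim \<omega>)
    from elim show ?case
    proof eventually_elim
      case (elim n)
      have "(\<Prod>i<n. ennreal (w (\<omega> i))) * b n \<omega> = (\<Prod>i<n. ennreal (w (\<omega> i) * (1 / w (\<omega> i))))"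
        unfolding b_def prod.distrib[symmetric]
        by (intro prod.cong refl ennreal_mult[symmetric]) (auto simp: less_imp_le[OF w_pos])
      also have "\<dots> = 1"
        by (intro prod.neutral) (auto simp: less_imp_neq[OF w_pos, symmetric])
      finally have "L n \<omega> = a n \<omega> * b n \<omega>"
        by (simp add: a_def mult.assoc)
      also have "\<dots> \<le> ennreal (s ^ n) * ennreal (s ^ n)"
        using elim by (intro mult_mono) auto
      also have "\<dots> = ennreal (\<rho> ^ n)"
        unfolding s(3)[symmetric] using s(1)
        by (simp add: power2_eq_square power_mult_distrib flip: ennreal_mult)
      finally show ?case by (simp add: L_def)
    qed
  qed
qed

subsection \<open>Compactness of sequences of linear functionals\<close>

text \<open>Without a finite net, points can be chosen greedily, each at distance at least
  \<open>\<delta>\<close> from all earlier ones. The new point is always the first argument of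
  \<open>d\<close>, so symmetry does not enter.\<close>

lemma finite_net_if_no_separated_sequence:
  fixes d :: "'a \<Rightarrow> 'a \<Rightarrow> real"
  assumes "\<And>s::nat \<Rightarrow> 'a. \<exists>m n. m < n \<and> d (s n) (s m) < \<delta>"
  shows "\<exists>F. finite F \<and> (\<forall>x. \<exists>b\<in>F. d x b < \<delta>)"
proof (rule ccontr)
  assume neg: "\<not> ?thesis"
  let ?Q = "\<lambda>s n x. \<forall>m<(n::nat). \<not> d x (s m) < \<delta>"
  have "\<exists>s. \<forall>n::nat. ?Q s n (s n)"
  proof (rule dependent_wellorder_choice)
    fix n :: nat and s :: "nat \<Rightarrow> 'a"
    have "finite (s ` {..<n})" by simp
    with neg show "\<exists>x. ?Q s n x" by (metis imageI lessThan_iff)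
  qed simp
  with assms show False by blast
qed

text \<open>Induction on the dimension of the span. A bounded sequence has a convergent subsequence.
  Otherwise some subsequence has directions converging to a unit vector \<theta>: functionals with
  \<open>v \<bullet> \<theta> \<noteq> 0\<close> then diverge with the sign of
  \<open>v \<bullet> \<theta>\<close>, while those orthogonal to \<theta> see only the projection of
  the sequence away from \<theta>, which spans a smaller space.\<close>

lemma subseq_inner_converges_extended:
  fixes b :: "nat \<Rightarrow> 'a::euclidean_space"
  shows "\<exists>r. strict_mono r \<and> (\<forall>v. convergent (\<lambda>n. v \<bullet> b (r n)) \<or>
            filterlim (\<lambda>n. v \<bullet> b (r n)) at_top sequentially \<or>
            filterlim (\<lambda>n. v \<bullet> b (r n)) at_bot sequentially)"
proof (induction "dim (range b)" arbitrary: b rule: less_induct)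
  case less
  show ?case
  proof (cases "bounded (range b)")
    case True
    then obtain l r where "strict_mono r" "(b \<circ> r) \<longlonglongrightarrow> l"
      using bounded_imp_convergent_subsequence by blast
    then have "convergent (\<lambda>n. v \<bullet> b (r n))" for v
      by (intro convergentI[of _ "v \<bullet> l"] tendsto_intros) (simp add: o_def)
    with \<open>strict_mono r\<close> show ?thesis by blast
  next
    case False
    \<comment> \<open>Any initial segment is finite, hence bounded, so large norms must occur
      arbitrarily late.\<close>
    have "\<exists>n>m. norm (b n) > real K" for m K
    proof (rule ccontr)
      assume "\<not> ?thesis"
      then have "norm (b n) \<le> Max (insert (real K) ((\<lambda>n. norm (b n)) ` {..m}))" for n
        by (cases "n \<le> m") (auto simp: Max_ge_iff not_less simp del: Max_insert)
      then have "bounded (range b)" by (auto intro!: boundedI)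
      with False show False by simp
    qed
    then have "\<exists>f. \<forall>n. norm (b (f n)) \<ge> real n \<and> f n < f (Suc n)"
      by (intro dependent_nat_choice) (simp, blast intro: less_imp_le)
    then obtain f where f: "strict_mono f" "\<And>n. norm (b (f n)) \<ge> real n"
      by (auto simp: strict_mono_Suc_iff)
    define e where "e n = b (f n) /\<^sub>R norm (b (f n))" for n
    have "bounded (range e)" by (auto intro!: boundedI[of _ 1] simp: e_def norm_sgn simp flip: sgn_div_norm)
    then obtain \<theta> g where g: "strict_mono g" and e_lim: "(e \<circ> g) \<longlonglongrightarrow> \<theta>"
      using bounded_imp_convergent_subsequence by blast
    define c where "c n = b (f (g n))" for n
    have c_large: "norm (c n) \<ge> real n" for n
      unfolding c_def using f(2)[of "g n"] seq_suble[OF g, of n] by linarith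
    have c_top: "filterlim (\<lambda>n. norm (c n)) at_top sequentially"
      by (rule filterlim_at_top_mono[OF filterlim_real_sequentially]) (use c_large in auto)
    have ec: "(\<lambda>n. c n /\<^sub>R norm (c n)) \<longlonglongrightarrow> \<theta>"
      using e_lim by (simp add: e_def c_def o_def)
    have "(\<lambda>n. norm (c n /\<^sub>R norm (c n))) \<longlonglongrightarrow> norm \<theta>" by (intro tendsto_intros ec)
    \<comment> \<open>Index 0 is left out because \<open>c 0\<close> may vanish, and division by its
      norm would then give the zero vector.\<close>
    moreover have "\<forall>\<^sub>F n in sequentially. norm (c n /\<^sub>R norm (c n)) = 1"
      using eventually_gt_at_top[of 0]
      by eventually_elim (metis c_large of_nat_0_less_iff norm_sgn norm_zero not_less sgn_div_norm)
    ultimately have "(\<lambda>n::nat. 1) \<longlonglongrightarrow> norm \<theta>" by (rule Lim_transform_eventually)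
    then have \<theta>1: "norm \<theta> = 1" by (simp add: LIMSEQ_const_iff)
    have \<theta>_span: "\<theta> \<in> span (range b)"
    proof (rule Lim_in_closed_set[OF closed_span _ _ ec])
      show "\<forall>\<^sub>F n in sequentially. c n /\<^sub>R norm (c n) \<in> span (range b)"
        by (intro always_eventually allI span_scale span_base) (auto simp: c_def)
    qed simp
    \<comment> \<open>The projection orthogonal to \<theta>. It stays inside the old span but its
      span misses \<theta>, which lies in the old span by closedness; hence the strict drop in
      dimension.\<close>
    define c' where "c' n = c n - (c n \<bullet> \<theta>) *\<^sub>R \<theta>" for n
    have "span (range c') \<subseteq> {v \<in> span (range b). v \<bullet> \<theta> = 0}"
    proof (rule span_minimal)
      show "range c' \<subseteq> {v \<in> span (range b). v \<bullet> \<theta> = 0}"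
        using \<theta>1 \<theta>_span
        by (auto simp: c'_def c_def inner_diff_left dot_square_norm
            intro: span_diff span_scale span_base)
      show "subspace {v \<in> span (range b). v \<bullet> \<theta> = 0}"
        by (auto simp: subspace_def span_zero span_add span_scale inner_add_left)
    qed
    moreover have "\<theta> \<bullet> \<theta> \<noteq> 0" using \<theta>1 by (metis inner_eq_zero_iff norm_zero zero_neq_one)
    ultimately have "span (range c') \<subset> span (range b)" using \<theta>_span by auto
    then have "dim (range c') < dim (range b)" by (rule dim_psubset)
    from less[OF this] obtain r where r: "strict_mono r" and
      conv: "\<And>v. convergent (\<lambda>n. v \<bullet> c' (r n)) \<or> filterlim (\<lambda>n. v \<bullet> c' (r n)) at_top sequentially \<or>
            filterlim (\<lambda>n. v \<bullet> c' (r n)) at_bot sequentially"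
      by auto
    have r_top: "filterlim r at_top sequentially" by (rule filterlim_subseq[OF r])
    have "convergent (\<lambda>n. v \<bullet> c (r n)) \<or> filterlim (\<lambda>n. v \<bullet> c (r n)) at_top sequentially \<or>
            filterlim (\<lambda>n. v \<bullet> c (r n)) at_bot sequentially" for v
    proof (cases "v \<bullet> \<theta> = 0")
      case True
      then show ?thesis using conv[of v] by (simp add: c'_def inner_diff_right)
    next
      case False
      have eq: "v \<bullet> c n = (v \<bullet> (c n /\<^sub>R norm (c n))) * norm (c n)" for n
        by (cases "c n = 0") auto
      have lim: "(\<lambda>n. v \<bullet> (c n /\<^sub>R norm (c n))) \<longlonglongrightarrow> v \<bullet> \<theta>" by (intro tendsto_intros ec)
      consider "v \<bullet> \<theta> > 0" | "v \<bullet> \<theta> < 0" using False by linarith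
      then show ?thesis
      proof cases
        case 1
        have "filterlim (\<lambda>n. v \<bullet> c n) at_top sequentially"
          by (subst eq) (rule filterlim_tendsto_pos_mult_at_top[OF lim 1 c_top])
        from filterlim_compose[OF this r_top] show ?thesis by blast
      next
        case 2
        have "filterlim (\<lambda>n. v \<bullet> c n) at_bot sequentially"
          by (subst eq) (rule filterlim_tendsto_neg_mult_at_bot[OF lim 2 c_top])
        from filterlim_compose[OF this r_top] show ?thesis by blast
      qed
    qed
    moreover have "strict_mono (\<lambda>n. f (g (r n)))"
      using f(1) g r by (simp add: strict_mono_def)
    ultimately show ?thesis unfolding c_def by blast
  qed
qed

subsection \<open>Logit kernels and their mixtures\<close>

lemma sum_exp_pos: "(\<Sum>l\<in>(UNIV::'c::finite set). exp (f l)) > (0::real)"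
  by (intro sum_pos) auto

lemma mnl_kernel_pos: "mnl_kernel j x \<beta> > 0"
  by (simp add: mnl_kernel_def sum_exp_pos)

lemma sum_mnl_kernel: "(\<Sum>j\<in>UNIV. mnl_kernel j x \<beta>) = 1"
  using sum_exp_pos[of "\<lambda>l. x $ l \<bullet> \<beta>"]
  by (simp add: mnl_kernel_def flip: sum_divide_distrib)

lemma mnl_kernel_le_1: "mnl_kernel j x \<beta> \<le> 1"
  using member_le_sum[of j UNIV "\<lambda>j. mnl_kernel j x \<beta>"]
  by (simp add: sum_mnl_kernel less_imp_le[OF mnl_kernel_pos])

lemma norm_mnl_kernel_le_1: "norm (mnl_kernel j x \<beta>) \<le> 1"
  using mnl_kernel_pos[of j x \<beta>] mnl_kernel_le_1[of j x \<beta>] by simp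

text \<open>In this form the kernel depends on \<beta> only through exponentials of linear
  functionals, and the term \<open>l = j\<close> equals 1, which keeps the denominator away from
  zero in the limit.\<close>

lemma mnl_kernel_altdef:
  "mnl_kernel j x \<beta> = inverse (\<Sum>l\<in>UNIV. exp ((x $ l - x $ j) \<bullet> \<beta>))"
  by (simp add: mnl_kernel_def inner_diff_left exp_diff inverse_eq_divide flip: sum_divide_distrib)

lemma continuous_on_mnl_kernel:
  "continuous_on UNIV (\<lambda>p. mnl_kernel j (fst p :: (real^'d)^'c::finite) (snd p))"
  unfolding mnl_kernel_def
  by (intro continuous_intros ballI less_imp_neq[THEN not_sym] sum_exp_pos)

lemma continuous_on_mnl_kernel_coeff: "continuous_on S (mnl_kernel j x)"
  using continuous_on_compose2[OF continuous_on_mnl_kernel[of j], of S "\<lambda>\<beta>. (x, \<beta>)"]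
  by (simp add: continuous_on_Pair continuous_on_const continuous_on_id)

lemma continuous_on_mnl_kernel_cov: "continuous_on S (\<lambda>x. mnl_kernel j x \<beta>)"
  using continuous_on_compose2[OF continuous_on_mnl_kernel[of j], of S "\<lambda>x. (x, \<beta>)"]
  by (simp add: continuous_on_Pair continuous_on_const continuous_on_id)

lemma borel_measurable_mnl_kernel [measurable (raw)]:
  fixes f :: "'a \<Rightarrow> (real^'d)^'c::finite"
  assumes "f \<in> borel_measurable N" "g \<in> borel_measurable N"
  shows "(\<lambda>a. mnl_kernel j (f a) (g a)) \<in> borel_measurable N"
  by (rule borel_measurable_continuous_Pair[OF assms])
     (use continuous_on_mnl_kernel[of j] in simp)

lemma PBorelD: assumes "G \<in> PBorel" shows "prob_space G" "sets G = sets borel"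
  using assms by (auto simp: space_prob_algebra)

lemma integrable_mnl_kernel:
  assumes "G \<in> PBorel" shows "integrable G (mnl_kernel j x)"
proof -
  interpret prob_space G by (rule PBorelD(1)[OF assms])
  note PBorelD(2)[OF assms, measurable_cong]
  show ?thesis by (rule integrable_const_bound[where B=1]) (auto simp: norm_mnl_kernel_le_1 simp del: real_norm_def)
qed

lemma mixq_pos: assumes "G \<in> PBorel" shows "mixq j x G > 0"
proof -
  interpret prob_space G by (rule PBorelD(1)[OF assms])
  show ?thesis unfolding mixq_def
    by (intro expectation_greater integrable_mnl_kernel assms) (simp add: mnl_kernel_pos)
qed

lemma sum_mixq: assumes "G \<in> PBorel" shows "(\<Sum>j\<in>UNIV. mixq j x G) = 1"
proof -
  interpret prob_space G by (rule PBorelD(1)[OF assms])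
  have "(\<Sum>j\<in>UNIV. mixq j x G) = (\<integral>\<beta>. (\<Sum>j\<in>UNIV. mnl_kernel j x \<beta>) \<partial>G)"
    unfolding mixq_def by (rule Bochner_Integration.integral_sum[symmetric]) (rule integrable_mnl_kernel[OF assms])
  then show ?thesis by (simp add: sum_mnl_kernel prob_space)
qed

lemma mixq_le_1: assumes "G \<in> PBorel" shows "mixq j x G \<le> 1"
  using member_le_sum[of j UNIV "\<lambda>j. mixq j x G"]
  by (simp add: sum_mixq[OF assms] less_imp_le[OF mixq_pos[OF assms]])

lemma ennreal_mixq: assumes "G \<in> PBorel"
  shows "ennreal (mixq j x G) = (\<integral>\<^sup>+\<beta>. ennreal (mnl_kernel j x \<beta>) \<partial>G)"
  unfolding mixq_def
  by (intro nn_integral_eq_integral[symmetric] integrable_mnl_kernel assms)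
     (auto simp: less_imp_le[OF mnl_kernel_pos])

text \<open>Measurability in the mixing distribution is available for nonnegative integrals, so the
  Bochner integral is rewritten as one. Letting covariate and distribution vary together yields the
  joint measurability that Tonelli requires of the likelihood ratio.\<close>

lemma borel_measurable_mixq:
  fixes f :: "'a \<Rightarrow> (real^'d)^'c::finite"
  assumes [measurable]: "f \<in> borel_measurable N" and g: "g \<in> N \<rightarrow>\<^sub>M prob_algebra borel"
  shows "(\<lambda>a. mixq j (f a) (g a)) \<in> borel_measurable N"
proof -
  have "(\<lambda>a. enn2real (\<integral>\<^sup>+\<beta>. ennreal (mnl_kernel j (f a) \<beta>) \<partial>(g a))) \<in> borel_measurable N"
    by (intro borel_measurable_enn2real nn_integral_measurable_subprob_algebra2[where N=borel] measurable_prob_algebraD g)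
       measurable
  also have "?this \<longleftrightarrow> ?thesis"
  proof (rule measurable_cong)
    fix a assume "a \<in> space N"
    then have "g a \<in> PBorel" using g by (rule measurable_space[rotated])
    then show "enn2real (\<integral>\<^sup>+\<beta>. ennreal (mnl_kernel j (f a) \<beta>) \<partial>(g a)) = mixq j (f a) (g a)"
      by (metis ennreal_mixq enn2real_ennreal mixq_pos less_imp_le)
  qed
  finally show ?thesis .
qed

lemma borel_measurable_mixq_cov:
  assumes "G \<in> PBorel" "sets M = sets borel"
  shows "(\<lambda>x. mixq j x G) \<in> borel_measurable M"
  using assms by (intro borel_measurable_mixq measurable_const) (auto cong: measurable_cong_sets)

lemma continuous_on_mixq_cov:
  assumes "G \<in> PBorel" shows "continuous_on S (\<lambda>x. mixq j x G)"
proof -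
  interpret prob_space G by (rule PBorelD(1)[OF assms])
  note PBorelD(2)[OF assms, measurable_cong]
  have "isCont (\<lambda>x. mixq j x G) x" for x
    unfolding continuous_at_sequentially o_def mixq_def
  proof (intro allI impI)
    fix u :: "nat \<Rightarrow> _" assume u: "u \<longlonglongrightarrow> x"
    have lim: "(\<lambda>n. mnl_kernel j (u n) \<beta>) \<longlonglongrightarrow> mnl_kernel j x \<beta>" for \<beta>
      using continuous_on_tendsto_compose[OF continuous_on_mnl_kernel_cov[of UNIV] u] by auto
    show "(\<lambda>n. \<integral>\<beta>. mnl_kernel j (u n) \<beta> \<partial>G) \<longlonglongrightarrow> (\<integral>\<beta>. mnl_kernel j x \<beta> \<partial>G)"
      by (rule integral_dominated_convergence[where w="\<lambda>_. 1"])
         (auto simp: lim norm_mnl_kernel_le_1 simp del: real_norm_def)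
  qed
  then show ?thesis by (intro continuous_at_imp_continuous_on) auto
qed

subsection \<open>Total boundedness in mean\<close>

definition kernel_dist :: "((real^'d)^'c::finite) measure \<Rightarrow> real^'d \<Rightarrow> real^'d \<Rightarrow> real" where
  "kernel_dist M \<beta> \<gamma> = (\<integral>x. (\<Sum>j\<in>UNIV. \<bar>mnl_kernel j x \<beta> - mnl_kernel j x \<gamma>\<bar>) \<partial>M)"

text \<open>The l1 norm over choices replaces the Euclidean norm of \<open>qdist\<close>, which it
  dominates. With it the distance is attained as a difference of means of one bounded function, the
  sign of the difference.\<close>

definition mixq_dist :: "((real^'d)^'c::finite) measure \<Rightarrow> (real^'d) measure \<Rightarrow> (real^'d) measure \<Rightarrow> real" where
  "mixq_dist M G1 G2 = (\<integral>x. (\<Sum>j\<in>UNIV. \<bar>mixq j x G1 - mixq j x G2\<bar>) \<partial>M)"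

text \<open>If one summand diverges, nonnegativity of the others makes the whole sum diverge and the
  inverse tend to 0. Otherwise the sum has a limit, at least 1 because of the constant summand,
  where inversion is continuous.\<close>

lemma convergent_inverse_sum:
  fixes f :: "'a \<Rightarrow> nat \<Rightarrow> real"
  assumes "finite I" "j \<in> I" and pos: "\<And>i n. 0 \<le> f i n" and one: "\<And>n. f j n = 1"
    and conv: "\<And>i. convergent (f i) \<or> filterlim (f i) at_top sequentially"
  shows "convergent (\<lambda>n. inverse (\<Sum>i\<in>I. f i n))"
proof (cases "\<exists>i\<in>I. filterlim (f i) at_top sequentially")
  case True
  then obtain i where i: "i \<in> I" "filterlim (f i) at_top sequentially" by blast
  have "filterlim (\<lambda>n. \<Sum>i\<in>I. f i n) at_top sequentially"
    using member_le_sum[OF i(1), of "\<lambda>i. f i _"] pos \<open>finite I\<close>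
    by (intro filterlim_at_top_mono[OF i(2)] always_eventually) auto
  then have "(\<lambda>n. inverse (\<Sum>i\<in>I. f i n)) \<longlonglongrightarrow> 0"
    by (rule tendsto_inverse_0_at_top)
  then show ?thesis by (rule convergentI)
next
  case False
  with conv have "\<forall>i\<in>I. \<exists>l. f i \<longlonglongrightarrow> l" by (auto simp: convergent_def)
  then obtain l where l: "\<And>i. i \<in> I \<Longrightarrow> f i \<longlonglongrightarrow> l i" by metis
  then have lim: "(\<lambda>n. \<Sum>i\<in>I. f i n) \<longlonglongrightarrow> (\<Sum>i\<in>I. l i)" by (rule tendsto_sum)
  have "f j n \<le> (\<Sum>i\<in>I. f i n)" for n
    using member_le_sum[OF \<open>j \<in> I\<close>, of "\<lambda>i. f i n"] pos \<open>finite I\<close> by auto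
  then have "1 \<le> (\<Sum>i\<in>I. l i)"
    by (intro LIMSEQ_le_const[OF lim]) (simp add: one)
  then show ?thesis using tendsto_inverse[OF lim] by (auto intro: convergentI)
qed

lemma subseq_mnl_kernel_convergent:
  fixes b :: "nat \<Rightarrow> real^'d"
  shows "\<exists>r. strict_mono r \<and> (\<forall>j (x :: (real^'d)^'c::finite). convergent (\<lambda>n. mnl_kernel j x (b (r n))))"
proof -
  obtain r where r: "strict_mono r" "\<And>v. convergent (\<lambda>n. v \<bullet> b (r n)) \<or>
            filterlim (\<lambda>n. v \<bullet> b (r n)) at_top sequentially \<or>
            filterlim (\<lambda>n. v \<bullet> b (r n)) at_bot sequentially"
    using subseq_inner_converges_extended[of b] by blast
  have "convergent (\<lambda>n. exp (v \<bullet> b (r n))) \<or> filterlim (\<lambda>n. exp (v \<bullet> b (r n))) at_top sequentially" for v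
    using r(2)[of v]
  proof (elim disjE)
    assume "convergent (\<lambda>n. v \<bullet> b (r n))"
    then show ?thesis by (auto simp: convergent_def intro!: tendsto_exp)
  next
    assume "filterlim (\<lambda>n. v \<bullet> b (r n)) at_top sequentially"
    then show ?thesis by (auto intro: filterlim_compose[OF exp_at_top])
  next
    assume "filterlim (\<lambda>n. v \<bullet> b (r n)) at_bot sequentially"
    then have "(\<lambda>n. exp (v \<bullet> b (r n))) \<longlonglongrightarrow> 0" by (rule filterlim_compose[OF exp_at_bot])
    then show ?thesis by (auto intro: convergentI)
  qed
  then have "convergent (\<lambda>n. mnl_kernel j x (b (r n)))" for j and x :: "(real^'d)^'c"
    unfolding mnl_kernel_altdef by (intro convergent_inverse_sum[where j=j]) auto
  with r(1) show ?thesis by blast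
qed

text \<open>Along the subsequence the kernels converge pointwise and boundedly, hence in mean, so
  two late terms are close to each other. The limit \<open>g\<close> need not be a logit kernel
  itself and serves only as an intermediate point.\<close>

lemma kernel_dist_finite_net:
  fixes M :: "((real^'d)^'c::finite) measure"
  assumes "prob_space M" and [measurable_cong]: "sets M = sets borel" and "\<delta> > 0"
  shows "\<exists>F. finite F \<and> (\<forall>\<beta>. \<exists>b\<in>F. kernel_dist M \<beta> b < \<delta>)"
proof (rule finite_net_if_no_separated_sequence)
  interpret prob_space M by fact
  fix s :: "nat \<Rightarrow> real^'d"
  obtain r where r: "strict_mono r"
    "\<And>j (x :: (real^'d)^'c). convergent (\<lambda>n. mnl_kernel j x (s (r n)))"
    using subseq_mnl_kernel_convergent[of s] by blast
  define k where "k n j x = mnl_kernel j x (s (r n))" for n j and x :: "(real^'d)^'c"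
  obtain g where g: "\<And>j x. (\<lambda>n. k n j x) \<longlonglongrightarrow> g j x"
    unfolding k_def using r(2) unfolding convergent_def by metis
  have [measurable]: "k n j \<in> borel_measurable M" for n j unfolding k_def by measurable
  have [measurable]: "g j \<in> borel_measurable M" for j
    by (rule borel_measurable_LIMSEQ_real[OF g]) measurable
  have k01: "0 \<le> k n j x" "k n j x \<le> 1" for n j x
    by (simp_all add: k_def mnl_kernel_le_1 less_imp_le[OF mnl_kernel_pos])
  have g01: "0 \<le> g j x" "g j x \<le> 1" for j x
    using LIMSEQ_le_const[OF g, of 0] LIMSEQ_le_const2[OF g, of _ _ 1] k01 by auto
  have bnd: "(\<Sum>j\<in>UNIV. \<bar>k n j x - g j x\<bar>) \<le> real CARD('c)" for n x
  proof -
    have "\<bar>k n j x - g j x\<bar> \<le> 1" for j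
      using k01[of n j x] g01[of j x] by linarith
    then show ?thesis using sum_bounded_above[of UNIV "\<lambda>j. \<bar>k n j x - g j x\<bar>" 1] by simp
  qed
  have int: "integrable M (\<lambda>x. \<Sum>j\<in>UNIV. \<bar>k n j x - g j x\<bar>)" for n
    by (rule integrable_const_bound[where B="real CARD('c)"]) (use bnd in \<open>auto simp: sum_nonneg\<close>)
  have "(\<lambda>n. \<integral>x. (\<Sum>j\<in>UNIV. \<bar>k n j x - g j x\<bar>) \<partial>M) \<longlonglongrightarrow> (\<integral>x. 0 \<partial>M)"
  proof (rule integral_dominated_convergence[where w="\<lambda>_. real CARD('c)"])
    have "(\<lambda>n. (\<Sum>j\<in>UNIV. \<bar>k n j x - g j x\<bar>)) \<longlonglongrightarrow> (\<Sum>j\<in>UNIV. \<bar>g j x - g j x\<bar>)" for x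
      by (intro tendsto_intros g)
    then show "AE x in M. (\<lambda>n. (\<Sum>j\<in>UNIV. \<bar>k n j x - g j x\<bar>)) \<longlonglongrightarrow> 0" by simp
  qed (use bnd in \<open>auto simp: sum_nonneg\<close>)
  then have "\<forall>\<^sub>F n in sequentially. (\<integral>x. (\<Sum>j\<in>UNIV. \<bar>k n j x - g j x\<bar>) \<partial>M) < \<delta> / 2"
    using \<open>\<delta> > 0\<close> by (intro order_tendstoD(2)) auto
  then obtain N where N: "\<And>n. n \<ge> N \<Longrightarrow> (\<integral>x. (\<Sum>j\<in>UNIV. \<bar>k n j x - g j x\<bar>) \<partial>M) < \<delta> / 2"
    by (auto simp: eventually_sequentially)
  have "kernel_dist M (s (r (Suc N))) (s (r N)) =
      (\<integral>x. (\<Sum>j\<in>UNIV. \<bar>k (Suc N) j x - k N j x\<bar>) \<partial>M)"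
    by (simp add: kernel_dist_def k_def)
  also have "\<dots> \<le> (\<integral>x. (\<Sum>j\<in>UNIV. \<bar>k (Suc N) j x - g j x\<bar>) + (\<Sum>j\<in>UNIV. \<bar>k N j x - g j x\<bar>) \<partial>M)"
    by (rule integral_mono'[OF Bochner_Integration.integrable_add[OF int int]])
       (auto simp flip: sum.distrib intro!: sum_mono sum_nonneg)
  also have "\<dots> < \<delta>"
    using N[of N] N[of "Suc N"] by (simp add: Bochner_Integration.integral_add[OF int int])
  finally show "\<exists>m n. m < n \<and> kernel_dist M (s n) (s m) < \<delta>"
    using strict_monoD[OF r(1), of N "Suc N"] by blast
qed

text \<open>Moving each coefficient to a net point of the kernels replaces \<open>G\<close> by its
  vector of cell masses, and finitely many rounded vectors suffice. The net is drawn from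
  \<open>A\<close>, so that for a set of distributions far from \<open>G0\<close> the centres are
  far from it as well.\<close>

lemma mixq_dist_finite_net:
  fixes M :: "((real^'d)^'c::finite) measure" and A :: "(real^'d) measure set"
  assumes "prob_space M" and [measurable_cong]: "sets M = sets borel" and A: "A \<subseteq> PBorel" and "\<tau> > 0"
  shows "\<exists>F\<subseteq>A. finite F \<and> (\<forall>G\<in>A. \<exists>G'\<in>F. mixq_dist M G G' < \<tau>)"
proof -
  interpret prob_space M by fact
  \<comment> \<open>Three errors of size \<open>\<delta>\<close> arise: discretising
    \<open>G\<close>, discretising \<open>G'\<close>, and rounding the masses. The fourth quarter
    makes the bound strict.\<close>
  define \<delta> where "\<delta> = \<tau> / 4"
  have "\<delta> > 0" using \<open>\<tau> > 0\<close> by (simp add: \<delta>_def)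
  obtain F0 where "finite F0" and F0: "\<And>\<beta>. \<exists>b\<in>F0. kernel_dist M \<beta> b < \<delta>"
    using kernel_dist_finite_net[OF assms(1,2) \<open>\<delta> > 0\<close>] by blast
  obtain N and b :: "nat \<Rightarrow> real^'d" where F0_eq: "F0 = b ` {i. i < N}"
    using finite_imp_nat_seg_image_inj_on[OF \<open>finite F0\<close>] by blast
  \<comment> \<open>The least admissible index puts every coefficient in exactly one cell and
    depends measurably on it.\<close>
  define idx where "idx \<beta> = (LEAST i. kernel_dist M \<beta> (b i) < \<delta>)" for \<beta>
  have idx: "kernel_dist M \<beta> (b (idx \<beta>)) < \<delta>" "idx \<beta> < N" for \<beta>
  proof -
    obtain i where i: "kernel_dist M \<beta> (b i) < \<delta>" "i < N" using F0[of \<beta>] F0_eq by blast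
    show "kernel_dist M \<beta> (b (idx \<beta>)) < \<delta>" unfolding idx_def by (rule LeastI[of _ i]) (rule i(1))
    show "idx \<beta> < N" using i unfolding idx_def by (meson Least_le le_less_trans)
  qed
  have [measurable]: "(\<lambda>\<beta>. kernel_dist M \<beta> c) \<in> borel_measurable borel" for c
    unfolding kernel_dist_def by measurable
  have [measurable]: "idx \<in> borel \<rightarrow>\<^sub>M count_space UNIV"
    unfolding idx_def by measurable
  define cell where "cell i = {\<beta>. idx \<beta> = i}" for i
  have [measurable]: "cell i \<in> sets borel" for i unfolding cell_def by measurable
  \<comment> \<open>The choice probabilities of the discretised distribution, with the mass of cell
    \<open>i\<close> placed at \<open>b i\<close>.\<close>
  define h where "h j x G = (\<Sum>i<N. measure G (cell i) * mnl_kernel j x (b i))"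
    for j and x :: "(real^'d)^'c" and G
  have kb_eq: "mnl_kernel j x (b (idx \<beta>)) = (\<Sum>i<N. indicator (cell i) \<beta> * mnl_kernel j x (b i))"
    for j and x :: "(real^'d)^'c" and \<beta>
  proof -
    have "(\<Sum>i<N. indicator (cell i) \<beta> * mnl_kernel j x (b i)) =
        (\<Sum>i<N. if i = idx \<beta> then mnl_kernel j x (b i) else 0)"
      by (intro sum.cong) (auto simp: cell_def)
    then show ?thesis using idx(2)[of \<beta>] by simp
  qed
  have near: "(\<integral>x. (\<Sum>j\<in>UNIV. \<bar>mixq j x G - h j x G\<bar>) \<partial>M) \<le> \<delta>" if G: "G \<in> PBorel" for G
  proof -
    interpret G: prob_space G by (rule PBorelD(1)[OF G])
    note PBorelD(2)[OF G, measurable_cong]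
    interpret MG: pair_prob_space M G ..
    define D where "D x \<beta> = (\<Sum>j\<in>UNIV. \<bar>mnl_kernel j x \<beta> - mnl_kernel j x (b (idx \<beta>))\<bar>)"
      for x :: "(real^'d)^'c" and \<beta>
    have [measurable]: "(\<lambda>p. D (fst p) (snd p)) \<in> borel_measurable (M \<Otimes>\<^sub>M G)"
      unfolding D_def by measurable
    have D_bnd: "0 \<le> D x \<beta>" "D x \<beta> \<le> 2" for x \<beta>
    proof -
      show "0 \<le> D x \<beta>" by (simp add: D_def sum_nonneg)
      have "D x \<beta> \<le> (\<Sum>j\<in>UNIV. mnl_kernel j x \<beta> + mnl_kernel j x (b (idx \<beta>)))"
        unfolding D_def
      proof (rule sum_mono)
        fix j show "\<bar>mnl_kernel j x \<beta> - mnl_kernel j x (b (idx \<beta>))\<bar> \<le> mnl_kernel j x \<beta> + mnl_kernel j x (b (idx \<beta>))"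
          using mnl_kernel_pos[of j x \<beta>] mnl_kernel_pos[of j x "b (idx \<beta>)"] by linarith
      qed
      then show "D x \<beta> \<le> 2" by (simp add: sum.distrib sum_mnl_kernel)
    qed
    have D_int: "integrable (M \<Otimes>\<^sub>M G) (\<lambda>(x, \<beta>). D x \<beta>)"
      by (rule MG.integrable_const_bound[where B=2]) (use D_bnd in \<open>auto simp: case_prod_unfold\<close>)
    have "(\<Sum>j\<in>UNIV. \<bar>mixq j x G - h j x G\<bar>) \<le> (\<integral>\<beta>. D x \<beta> \<partial>G)" for x
    proof -
      have int_b: "integrable G (\<lambda>\<beta>. mnl_kernel j x (b (idx \<beta>)))" for j
        by (rule G.integrable_const_bound[where B=1]) (auto simp: norm_mnl_kernel_le_1 simp del: real_norm_def)
      have int_d: "integrable G (\<lambda>\<beta>. mnl_kernel j x \<beta> - mnl_kernel j x (b (idx \<beta>)))" for j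
        by (intro Bochner_Integration.integrable_diff int_b integrable_mnl_kernel G)
      have "h j x G = (\<integral>\<beta>. mnl_kernel j x (b (idx \<beta>)) \<partial>G)" for j
        unfolding kb_eq h_def by (subst Bochner_Integration.integral_sum) (auto simp: G.emeasure_eq_measure)
      then have "mixq j x G - h j x G = (\<integral>\<beta>. mnl_kernel j x \<beta> - mnl_kernel j x (b (idx \<beta>)) \<partial>G)" for j
        by (simp add: mixq_def Bochner_Integration.integral_diff[OF integrable_mnl_kernel[OF G] int_b])
      then have "(\<Sum>j\<in>UNIV. \<bar>mixq j x G - h j x G\<bar>) \<le>
          (\<Sum>j\<in>UNIV. \<integral>\<beta>. \<bar>mnl_kernel j x \<beta> - mnl_kernel j x (b (idx \<beta>))\<bar> \<partial>G)"
        by (auto intro!: sum_mono integral_abs_bound)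
      also have "\<dots> = (\<integral>\<beta>. D x \<beta> \<partial>G)"
        unfolding D_def by (intro Bochner_Integration.integral_sum[symmetric] integrable_abs int_d)
      finally show ?thesis .
    qed
    then have "(\<integral>x. (\<Sum>j\<in>UNIV. \<bar>mixq j x G - h j x G\<bar>) \<partial>M) \<le> (\<integral>x. (\<integral>\<beta>. D x \<beta> \<partial>G) \<partial>M)"
      using MG.integrable_fst[OF D_int] D_bnd by (intro integral_mono') auto
    \<comment> \<open>After the exchange the inner integral is
      \<open>kernel_dist M \<beta> (b (idx \<beta>))\<close>, below \<open>\<delta>\<close> for
      every \<beta>.\<close>
    also have "\<dots> = (\<integral>\<beta>. (\<integral>x. D x \<beta> \<partial>M) \<partial>G)"
      by (rule MG.Fubini_integral[symmetric]) (rule D_int)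
    also have "\<dots> \<le> (\<integral>\<beta>. \<delta> \<partial>G)"
      using idx(1) \<open>\<delta> > 0\<close> by (intro integral_mono') (auto simp: D_def kernel_dist_def less_imp_le)
    also have "\<dots> = \<delta>" by (simp add: G.prob_space)
    finally show ?thesis .
  qed
  \<comment> \<open>Equal floors leave a discrepancy of at most \<open>1 / K\<close> in each of
    \<open>N\<close> cells, and the kernels at a net point sum to 1 over choices, so the rounding
    error is at most \<open>N / K\<close>.\<close>
  obtain K :: nat where K: "real N / \<delta> < real K" using reals_Archimedean2 by blast
  have K0: "0 < real K" using K \<open>\<delta> > 0\<close> by (smt (verit) divide_nonneg_pos of_nat_0_le_iff)
  define v where "v G = (\<lambda>i\<in>{..<N}. \<lfloor>real K * measure G (cell i)\<rfloor>)" for G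
  have "v ` A \<subseteq> {..<N} \<rightarrow>\<^sub>E {0..int K}"
  proof (intro image_subsetI)
    fix G assume "G \<in> A"
    then interpret G: prob_space G using A PBorelD(1) by blast
    have "\<lfloor>real K * measure G (cell i)\<rfloor> \<le> int K" for i
      using mult_left_mono[OF G.prob_le_1[of "cell i"], of "real K"] by (simp add: floor_le_iff)
    then show "v G \<in> {..<N} \<rightarrow>\<^sub>E {0..int K}" by (auto simp: v_def)
  qed
  then have "finite (v ` A)" by (rule finite_subset) (auto intro!: finite_PiE)
  \<comment> \<open>One member of \<open>A\<close> is kept for each rounded mass vector that
    occurs.\<close>
  then obtain F where F: "F \<subseteq> A" "finite F" "v ` A = v ` F"
    using finite_subset_image[of "v ` A" v A] by auto
  have "mixq_dist M G G' < \<tau>" if "G \<in> A" "G' \<in> F" "v G = v G'" for G G'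
  proof -
    have GP: "G \<in> PBorel" "G' \<in> PBorel" using that F A by auto
    have cell_close: "\<bar>measure G (cell i) - measure G' (cell i)\<bar> \<le> 1 / real K" if "i < N" for i
    proof -
      have "\<lfloor>real K * measure G (cell i)\<rfloor> = \<lfloor>real K * measure G' (cell i)\<rfloor>"
        using fun_cong[OF \<open>v G = v G'\<close>, of i] \<open>i < N\<close> by (simp add: v_def)
      then have "\<bar>real K * measure G (cell i) - real K * measure G' (cell i)\<bar> \<le> 1" by linarith
      then have "real K * \<bar>measure G (cell i) - measure G' (cell i)\<bar> \<le> 1"
        using K0 by (simp add: abs_mult flip: right_diff_distrib)
      then show ?thesis using K0 by (simp add: field_simps)
    qed
    have hh: "(\<Sum>j\<in>UNIV. \<bar>h j x G - h j x G'\<bar>) \<le> \<delta>" for x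
    proof -
      have "(\<Sum>j\<in>UNIV. \<bar>h j x G - h j x G'\<bar>) \<le> (\<Sum>j\<in>UNIV. \<Sum>i<N. 1 / real K * mnl_kernel j x (b i))"
      proof (rule sum_mono)
        fix j
        have "h j x G - h j x G' = (\<Sum>i<N. (measure G (cell i) - measure G' (cell i)) * mnl_kernel j x (b i))"
          by (simp add: h_def left_diff_distrib sum_subtractf)
        also have "\<bar>\<dots>\<bar> \<le> (\<Sum>i<N. 1 / real K * mnl_kernel j x (b i))"
        proof (intro order_trans[OF sum_abs] sum_mono)
          fix i assume "i \<in> {..<N}"
          then show "\<bar>(measure G (cell i) - measure G' (cell i)) * mnl_kernel j x (b i)\<bar>
              \<le> 1 / real K * mnl_kernel j x (b i)"
            using cell_close[of i] mnl_kernel_pos[of j x "b i"]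
            unfolding abs_mult by (intro mult_mono) auto
        qed
        finally show "\<bar>h j x G - h j x G'\<bar> \<le> (\<Sum>i<N. 1 / real K * mnl_kernel j x (b i))" .
      qed
      also have "\<dots> = (\<Sum>i<N. 1 / real K)"
        by (subst sum.swap) (simp add: sum_mnl_kernel flip: sum_distrib_left sum_divide_distrib)
      also have "\<dots> \<le> \<delta>" using K K0 \<open>\<delta> > 0\<close> by (simp add: field_simps)
      finally show ?thesis .
    qed
    note borel_measurable_mixq_cov[OF GP(1) assms(2), measurable] borel_measurable_mixq_cov[OF GP(2) assms(2), measurable]
    have [measurable]: "(\<lambda>x. h j x H) \<in> borel_measurable M" for j H unfolding h_def by measurable
    have int_h: "integrable M (\<lambda>x. \<Sum>j\<in>UNIV. \<bar>mixq j x H - h j x H\<bar>)" if "H \<in> {G, G'}" for H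
    proof -
      have HP: "H \<in> PBorel" using that GP by auto
      then interpret H: prob_space H by (rule PBorelD(1))
      have [measurable]: "(\<lambda>x. mixq j x H) \<in> borel_measurable M" for j using that by auto
      have h_nonneg: "0 \<le> h j x H" for j x
        by (auto simp: h_def less_imp_le[OF mnl_kernel_pos] intro!: sum_nonneg)
      have h_le: "h j x H \<le> real N" for j x
        unfolding h_def using sum_mono[of "{..<N}" "\<lambda>i. measure H (cell i) * mnl_kernel j x (b i)" "\<lambda>_. 1"]
        by (auto simp: mult_le_one mnl_kernel_le_1 less_imp_le[OF mnl_kernel_pos])
      have "\<bar>mixq j x H - h j x H\<bar> \<le> 1 + real N" for j x
        using h_nonneg[of j x] h_le[of j x] mixq_pos[OF HP, of j x] mixq_le_1[OF HP, of j x] by linarith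
      then have "integrable M (\<lambda>x. \<bar>mixq j x H - h j x H\<bar>)" for j
        by (intro integrable_const_bound[where B="1 + real N"]) auto
      then show ?thesis by (intro Bochner_Integration.integrable_sum)
    qed
    let ?I = "\<lambda>H x. \<Sum>j\<in>UNIV. \<bar>mixq j x H - h j x H\<bar>"
    have "mixq_dist M G G' \<le> (\<integral>x. ?I G x + ?I G' x + \<delta> \<partial>M)"
      unfolding mixq_dist_def
    proof (rule integral_mono')
      fix x
      have "(\<Sum>j\<in>UNIV. \<bar>mixq j x G - mixq j x G'\<bar>) \<le> (\<Sum>j\<in>UNIV. \<bar>mixq j x G - h j x G\<bar> + \<bar>mixq j x G' - h j x G'\<bar> + \<bar>h j x G - h j x G'\<bar>)"
        by (intro sum_mono) linarith
      also have "\<dots> \<le> ?I G x + ?I G' x + \<delta>" using hh[of x] by (simp add: sum.distrib)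
      finally show "(\<Sum>j\<in>UNIV. \<bar>mixq j x G - mixq j x G'\<bar>) \<le> ?I G x + ?I G' x + \<delta>" .
      show "0 \<le> ?I G x + ?I G' x + \<delta>" using \<open>\<delta> > 0\<close> by (intro add_nonneg_nonneg sum_nonneg) auto
    qed (auto intro!: int_h)
    also have "\<dots> = (\<integral>x. ?I G x \<partial>M) + (\<integral>x. ?I G' x \<partial>M) + \<delta>"
      using int_h[of G] int_h[of G'] by (simp add: prob_space)
    also have "\<dots> \<le> 3 * \<delta>" using near[OF GP(1)] near[OF GP(2)] by simp
    also have "\<dots> < \<tau>" using \<open>\<tau> > 0\<close> by (simp add: \<delta>_def)
    finally show ?thesis .
  qed
  then have "\<forall>G\<in>A. \<exists>G'\<in>F. mixq_dist M G G' < \<tau>" using F(3) by (metis imageE imageI)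
  with F show ?thesis by blast
qed

subsection \<open>Weak neighbourhoods\<close>

text \<open>Uniform continuity on the compact product with a ball of coefficients. The bound on
  \<beta> matters, since the kernels steepen in the covariates as \<beta> grows.\<close>

lemma uniform_mnl_kernel_modulus:
  fixes X :: "((real^'d)^'c::finite) set"
  assumes "compact X" "\<eta> > 0"
  shows "\<exists>\<delta>>0. \<forall>j. \<forall>x\<in>X. \<forall>y\<in>X. \<forall>\<beta>\<in>cball 0 R. dist x y < \<delta> \<longrightarrow> \<bar>mnl_kernel j x \<beta> - mnl_kernel j y \<beta>\<bar> < \<eta>"
proof -
  have "\<exists>\<delta>>0. \<forall>x\<in>X. \<forall>y\<in>X. \<forall>\<beta>\<in>cball 0 R. dist x y < \<delta> \<longrightarrow> \<bar>mnl_kernel j x \<beta> - mnl_kernel j y \<beta>\<bar> < \<eta>" for j :: 'c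
  proof -
    have "uniformly_continuous_on (X \<times> cball 0 R) (\<lambda>p. mnl_kernel j (fst p :: (real^'d)^'c) (snd p))"
      using continuous_on_subset[OF continuous_on_mnl_kernel] assms
      by (intro compact_uniformly_continuous compact_Times) auto
    then obtain \<delta> where "\<delta> > 0" and \<delta>: "\<And>p q. p \<in> X \<times> cball 0 R \<Longrightarrow> q \<in> X \<times> cball 0 R \<Longrightarrow> dist q p < \<delta> \<Longrightarrow>
        dist (mnl_kernel j (fst q) (snd q)) (mnl_kernel j (fst p) (snd p)) < \<eta>"
      unfolding uniformly_continuous_on_def using \<open>\<eta> > 0\<close> by metis
    show ?thesis
    proof (intro exI[of _ \<delta>] conjI ballI impI \<open>\<delta> > 0\<close>)
      fix x y \<beta> assume "x \<in> X" "y \<in> X" "\<beta> \<in> cball (0::real^'d) R" "dist x y < \<delta>"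
      then show "\<bar>mnl_kernel j x \<beta> - mnl_kernel j y \<beta>\<bar> < \<eta>"
        using \<delta>[of "(y, \<beta>)" "(x, \<beta>)"] by (simp add: dist_Pair_Pair dist_real_def)
    qed
  qed
  then obtain \<delta> where \<delta>: "\<And>j::'c. \<delta> j > 0" "\<And>j x y \<beta>. x \<in> X \<Longrightarrow> y \<in> X \<Longrightarrow> \<beta> \<in> cball 0 R \<Longrightarrow>
      dist x y < \<delta> j \<Longrightarrow> \<bar>mnl_kernel j x \<beta> - mnl_kernel j y \<beta>\<bar> < \<eta>"
    by metis
  show ?thesis
    by (rule exI[of _ "Min (range \<delta>)"]) (auto simp: \<delta>)
qed

text \<open>The ramp rises from 0 at norm \<open>R\<close> to 1 at norm \<open>R + 1\<close>. Unlike
  the indicator of a tail it is continuous, so a bound on its integral defines a weakly open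
  set.\<close>

lemma exists_tail_function:
  fixes G :: "(real^'d) measure"
  assumes "G \<in> PBorel" "\<eta> > 0"
  shows "\<exists>R. (\<integral>\<beta>. max 0 (min 1 (norm \<beta> - R)) \<partial>G) < \<eta>"
proof -
  interpret prob_space G by (rule PBorelD(1)[OF assms(1)])
  note PBorelD(2)[OF assms(1), measurable_cong]
  have "(\<lambda>n. \<integral>\<beta>. max 0 (min 1 (norm \<beta> - real n)) \<partial>G) \<longlonglongrightarrow> (\<integral>\<beta>. 0 \<partial>G)"
  proof (rule integral_dominated_convergence[where w="\<lambda>_. 1"])
    have "(\<lambda>n. max 0 (min 1 (norm \<beta> - real n))) \<longlonglongrightarrow> 0" for \<beta> :: "real^'d"
    proof (rule tendsto_eventually)
      show "\<forall>\<^sub>F n in sequentially. max 0 (min 1 (norm \<beta> - real n)) = 0"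
        using eventually_ge_at_top[of "nat \<lceil>norm \<beta>\<rceil>"] by eventually_elim linarith
    qed
    then show "AE \<beta> in G. (\<lambda>n. max 0 (min 1 (norm \<beta> - real n))) \<longlonglongrightarrow> 0" by simp
  qed auto
  then have "\<forall>\<^sub>F n in sequentially. (\<integral>\<beta>. max 0 (min 1 (norm \<beta> - real n)) \<partial>G) < \<eta>"
    using assms(2) by (intro order_tendstoD) auto
  then show ?thesis by (auto dest: eventually_happens)
qed

text \<open>A weak neighbourhood controls the choice probabilities at finitely many covariates only.
  Uniformity over \<open>X\<close> comes from equicontinuity in the covariate, which holds once the
  tail mass of \<open>G\<close> is constrained too; that constraint is built into
  \<open>U\<close>.\<close>

lemma weak_neighbourhood_mixq_uniformly_close:
  fixes X :: "((real^'d)^'c::finite) set"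
  assumes "compact X" and G0: "G0 \<in> PBorel" and "\<eta> > 0"
  shows "\<exists>U. openin weak_topology U \<and> G0 \<in> U \<and> U \<subseteq> PBorel \<and>
    (\<forall>G\<in>U. \<forall>j. \<forall>x\<in>X. \<bar>mixq j x G - mixq j x G0\<bar> \<le> 5 * \<eta>)"
proof -
  obtain R where R: "(\<integral>\<beta>. max 0 (min 1 (norm \<beta> - R)) \<partial>G0) < \<eta>"
    using exists_tail_function[OF G0 \<open>\<eta> > 0\<close>] by blast
  define f where "f \<beta> = max 0 (min 1 (norm \<beta> - R))" for \<beta> :: "real^'d"
  obtain \<delta> where "\<delta> > 0" and \<delta>: "\<And>(j::'c) x y \<beta>. x \<in> X \<Longrightarrow> y \<in> X \<Longrightarrow> norm \<beta> \<le> R + 1 \<Longrightarrow> dist x y < \<delta> \<Longrightarrow>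
      \<bar>mnl_kernel j x \<beta> - mnl_kernel j y \<beta>\<bar> < \<eta>"
    using uniform_mnl_kernel_modulus[OF \<open>compact X\<close> \<open>\<eta> > 0\<close>, of "R + 1"] by auto
  obtain S where S: "finite S" "S \<subseteq> X" "X \<subseteq> (\<Union>x\<in>S. ball x \<delta>)"
    using seq_compact_imp_totally_bounded[OF compact_imp_seq_compact[OF \<open>compact X\<close>]] \<open>\<delta> > 0\<close> by metis
  have lip: "\<bar>mixq j x G - mixq j y G\<bar> \<le> 2 * \<eta>"
    if G: "G \<in> PBorel" "(\<integral>\<beta>. f \<beta> \<partial>G) < \<eta>" and xy: "x \<in> X" "y \<in> X" "dist x y < \<delta>" for G x y and j :: 'c
  proof -
    interpret prob_space G by (rule PBorelD(1)[OF G(1)])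
    note PBorelD(2)[OF G(1), measurable_cong]
    have f_int: "integrable G f"
      unfolding f_def by (rule integrable_const_bound[where B=1]) auto
    \<comment> \<open>Up to norm \<open>R + 1\<close> the uniform modulus applies; beyond it the
      ramp equals 1, which bounds any difference of two kernels.\<close>
    have "\<bar>mnl_kernel j x \<beta> - mnl_kernel j y \<beta>\<bar> \<le> \<eta> + f \<beta>" for \<beta>
    proof (cases "norm \<beta> \<le> R + 1")
      case True
      then show ?thesis using \<delta>[OF xy(1,2) True xy(3), of j] by (simp add: f_def)
    next
      case False
      then have "f \<beta> = 1" by (simp add: f_def)
      then show ?thesis
        using mnl_kernel_pos[of j x \<beta>] mnl_kernel_pos[of j y \<beta>] mnl_kernel_le_1[of j x \<beta>]
          mnl_kernel_le_1[of j y \<beta>] \<open>\<eta> > 0\<close> by linarith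
    qed
    moreover have "0 \<le> f \<beta>" for \<beta> by (simp add: f_def)
    ultimately have "(\<integral>\<beta>. \<bar>mnl_kernel j x \<beta> - mnl_kernel j y \<beta>\<bar> \<partial>G) \<le> (\<integral>\<beta>. \<eta> + f \<beta> \<partial>G)"
      using f_int \<open>\<eta> > 0\<close> by (intro integral_mono') (auto intro!: add_nonneg_nonneg)
    also have "\<dots> = \<eta> + (\<integral>\<beta>. f \<beta> \<partial>G)" using f_int by (simp add: prob_space)
    also have "\<dots> \<le> 2 * \<eta>" using G(2) by simp
    finally show ?thesis
      unfolding mixq_def
      by (subst Bochner_Integration.integral_diff[symmetric])
         (auto intro!: integrable_mnl_kernel G(1) intro: order_trans[OF integral_abs_bound])
  qed
  define V where "V g T = {G \<in> PBorel. (\<integral>\<beta>. g \<beta> \<partial>G) \<in> T}" for g :: "real^'d \<Rightarrow> real" and T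
  have V_open: "openin weak_topology (V g T)" if "continuous_on UNIV g" "bounded (range g)" "open T" for g T
    unfolding weak_topology_def V_def using that by (intro topology_generated_by_Basis) blast
  \<comment> \<open>A finite intersection of subbasic sets: one tail constraint, and one constraint
    for each choice and each point of the covariate net.\<close>
  define U where "U = \<Inter> (insert (V f {..<\<eta>}) ((\<lambda>(x, j). V (mnl_kernel j x) (ball (mixq j x G0) \<eta>)) ` (S \<times> (UNIV :: 'c set))))"
  have "openin weak_topology U"
    unfolding U_def
  proof (rule openin_Inter)
    have "continuous_on UNIV f" unfolding f_def by (intro continuous_intros)
    moreover have "bounded (range f)" by (auto intro!: boundedI[of _ 1] simp: f_def)
    moreover have "bounded (range (mnl_kernel j x))" for j :: 'c and x
      by (auto intro!: boundedI[of _ 1] simp: norm_mnl_kernel_le_1 simp del: real_norm_def)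
    ultimately show "openin weak_topology W"
      if "W \<in> insert (V f {..<\<eta>}) ((\<lambda>(x, j). V (mnl_kernel j x) (ball (mixq j x G0) \<eta>)) ` (S \<times> (UNIV :: 'c set)))" for W
      using that by (auto intro!: V_open continuous_on_mnl_kernel_coeff)
  qed (use S in auto)
  moreover have "G0 \<in> U"
    using G0 R \<open>\<eta> > 0\<close> by (auto simp: U_def V_def f_def mixq_def)
  moreover have "U \<subseteq> PBorel" by (auto simp: U_def V_def)
  \<comment> \<open>The factor 5 adds \<open>2 * \<eta>\<close> for moving to the net point under
    \<open>G\<close>, \<open>\<eta>\<close> at the net point, and \<open>2 * \<eta>\<close> for
    moving back under \<open>G0\<close>.\<close>
  moreover have "\<bar>mixq j x G - mixq j x G0\<bar> \<le> 5 * \<eta>" if "G \<in> U" "x \<in> X" for G j x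
  proof -
    obtain y where y: "y \<in> S" "dist x y < \<delta>" using S(3) \<open>x \<in> X\<close> by (auto simp: dist_commute)
    have "(\<integral>\<beta>. f \<beta> \<partial>G) < \<eta>" "G \<in> PBorel" using \<open>G \<in> U\<close> by (auto simp: U_def V_def)
    then have "\<bar>mixq j x G - mixq j y G\<bar> \<le> 2 * \<eta>" using lip y S \<open>x \<in> X\<close> by blast
    moreover have "\<bar>mixq j x G0 - mixq j y G0\<bar> \<le> 2 * \<eta>"
      using lip[OF G0] y S \<open>x \<in> X\<close> R unfolding f_def by blast
    moreover have "G \<in> V (mnl_kernel j y) (ball (mixq j y G0) \<eta>)"
      using \<open>G \<in> U\<close> y(1) unfolding U_def by blast
    then have "\<bar>mixq j y G - mixq j y G0\<bar> < \<eta>"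
      by (simp add: V_def mixq_def dist_real_def abs_minus_commute)
    ultimately show ?thesis by linarith
  qed
  ultimately show ?thesis by blast
qed

lemma mixq_bounded_below:
  fixes X :: "((real^'d)^'c::finite) set"
  assumes "compact X" "G \<in> PBorel"
  shows "\<exists>c>0. \<forall>j. \<forall>x\<in>X. c \<le> mixq j x G"
proof -
  have "\<exists>c>0. \<forall>x\<in>X. c \<le> mixq j x G" for j :: 'c
  proof (cases "X = {}")
    case False
    then show ?thesis
      using continuous_attains_inf[OF \<open>compact X\<close> False continuous_on_mixq_cov[OF assms(2)], of j]
        mixq_pos[OF assms(2)] by metis
  qed (auto intro: exI[of _ 1])
  then obtain c where "\<And>j::'c. c j > 0 \<and> (\<forall>x\<in>X. c j \<le> mixq j x G)" by metis
  then show ?thesis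
    by (intro exI[of _ "Min (range c)"]) (auto simp: Min_le_iff)
qed

lemma weak_neighbourhood_mixq_ratio:
  fixes X :: "((real^'d)^'c::finite) set"
  assumes "compact X" "G0 \<in> PBorel" "\<kappa> < 1"
  shows "\<exists>U. openin weak_topology U \<and> G0 \<in> U \<and> U \<subseteq> PBorel \<and>
    (\<forall>G\<in>U. \<forall>j. \<forall>x\<in>X. \<kappa> \<le> mixq j x G / mixq j x G0)"
proof -
  obtain c where "c > 0" and c: "\<And>j x. x \<in> X \<Longrightarrow> c \<le> mixq j x G0"
    using mixq_bounded_below[OF assms(1,2)] by blast
  \<comment> \<open>This choice makes the deviation at most \<open>(1 - \<kappa>) * c\<close>, hence
    at most \<open>1 - \<kappa>\<close> times the probability under \<open>G0\<close>.\<close>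
  have "0 < (1 - \<kappa>) * c / 5" using \<open>c > 0\<close> \<open>\<kappa> < 1\<close> by simp
  from weak_neighbourhood_mixq_uniformly_close[OF assms(1,2) this]
  obtain U where U: "openin weak_topology U" "G0 \<in> U" "U \<subseteq> PBorel"
    and close: "\<And>G j x. G \<in> U \<Longrightarrow> x \<in> X \<Longrightarrow> \<bar>mixq j x G - mixq j x G0\<bar> \<le> (1 - \<kappa>) * c"
    by auto
  have "\<kappa> \<le> mixq j x G / mixq j x G0" if "G \<in> U" "x \<in> X" for G j x
  proof -
    have "(1 - \<kappa>) * c \<le> (1 - \<kappa>) * mixq j x G0"
      using c[OF \<open>x \<in> X\<close>, of j] \<open>\<kappa> < 1\<close> by (intro mult_left_mono) auto
    then have "\<kappa> * mixq j x G0 \<le> mixq j x G"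
      using close[OF that, of j] by (simp add: left_diff_distrib)
    then show ?thesis using mixq_pos[OF assms(2), of j x] by (simp add: pos_le_divide_eq)
  qed
  with U show ?thesis by blast
qed

subsection \<open>Separating test functions\<close>

lemma sets_obs_law: "sets (obs_law M G0) = sets (count_space UNIV \<Otimes>\<^sub>M M)"
  by (simp add: obs_law_def)

lemma borel_measurable_mixq_choice:
  fixes f :: "'a \<Rightarrow> (real^'d)^'c::finite"
  assumes "y \<in> N \<rightarrow>\<^sub>M count_space UNIV" "f \<in> borel_measurable N" "g \<in> N \<rightarrow>\<^sub>M prob_algebra borel"
  shows "(\<lambda>a. mixq (y a) (f a) (g a)) \<in> borel_measurable N"
  by (rule measurable_compose_countable[OF borel_measurable_mixq[OF assms(2,3)] assms(1)])

lemma nn_integral_obs_law: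
  fixes M :: "((real^'d)^'c::finite) measure"
  assumes "prob_space M" and M_sets[measurable_cong]: "sets M = sets borel" and G0: "G0 \<in> PBorel"
    and f [measurable]: "f \<in> borel_measurable (count_space UNIV \<Otimes>\<^sub>M M)"
  shows "(\<integral>\<^sup>+z. f z \<partial>obs_law M G0) = (\<integral>\<^sup>+x. (\<Sum>y\<in>UNIV. ennreal (mixq y x G0) * f (y, x)) \<partial>M)"
proof -
  interpret prob_space M by fact
  have [measurable]: "(\<lambda>z. mixq (fst z) (snd z) G0) \<in> borel_measurable (count_space UNIV \<Otimes>\<^sub>M M)"
    by (intro borel_measurable_mixq_choice measurable_const G0) auto
  have [measurable]: "(\<lambda>x. mixq y x G0) \<in> borel_measurable M" for y
    by (rule borel_measurable_mixq_cov[OF G0 M_sets])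
  have [measurable]: "(\<lambda>x. f (y, x)) \<in> borel_measurable M" for y
    using measurable_Pair2[OF f, of y] by simp
  have "(\<integral>\<^sup>+z. f z \<partial>obs_law M G0) =
      (\<integral>\<^sup>+z. ennreal (mixq (fst z) (snd z) G0) * f z \<partial>(count_space UNIV \<Otimes>\<^sub>M M))"
    unfolding obs_law_def case_prod_unfold by (subst nn_integral_density) auto
  also have "\<dots> = (\<integral>\<^sup>+y. (\<integral>\<^sup>+x. ennreal (mixq y x G0) * f (y, x) \<partial>M) \<partial>count_space UNIV)"
    by (subst nn_integral_fst[symmetric]) auto
  also have "\<dots> = (\<integral>\<^sup>+x. (\<Sum>y\<in>UNIV. ennreal (mixq y x G0) * f (y, x)) \<partial>M)"
    by (simp add: nn_integral_count_space_finite nn_integral_sum)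
  finally show ?thesis .
qed

lemma prob_space_obs_law:
  fixes M :: "((real^'d)^'c::finite) measure"
  assumes "prob_space M" "sets M = sets borel" "G0 \<in> PBorel"
  shows "prob_space (obs_law M G0)"
proof
  interpret prob_space M by fact
  have "emeasure (obs_law M G0) (space (obs_law M G0)) = (\<integral>\<^sup>+z. 1 \<partial>obs_law M G0)" by simp
  also have "\<dots> = (\<integral>\<^sup>+x. (\<Sum>y\<in>UNIV. ennreal (mixq y x G0) * 1) \<partial>M)"
    by (rule nn_integral_obs_law[OF assms]) simp
  also have "\<dots> = 1"
    by (simp add: sum_ennreal less_imp_le[OF mixq_pos[OF assms(3)]] sum_mixq[OF assms(3)] emeasure_space_1)
  finally show "emeasure (obs_law M G0) (space (obs_law M G0)) = 1" .
qed

text \<open>The covariate marginal of the law is \<open>M\<close>. This is what allows likelihood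
  bounds proved only for covariates in \<open>X\<close> to be applied to the data.\<close>

lemma AE_obs_law_covariate:
  fixes M :: "((real^'d)^'c::finite) measure"
  assumes "prob_space M" "sets M = sets borel" "G0 \<in> PBorel" "X \<in> sets M" "emeasure M X = 1"
  shows "AE z in obs_law M G0. snd z \<in> X"
proof -
  interpret prob_space M by fact
  have [measurable]: "X \<in> sets M" by fact
  have "(\<integral>\<^sup>+z. indicator (- X) (snd z) \<partial>obs_law M G0) =
      (\<integral>\<^sup>+x. (\<Sum>y\<in>UNIV. ennreal (mixq y x G0) * indicator (- X) (snd (y, x))) \<partial>M)"
    by (rule nn_integral_obs_law[OF assms(1-3)]) (use assms in measurable)
  also have "\<dots> = (\<integral>\<^sup>+x. 0 \<partial>M)"
  proof (rule nn_integral_cong_AE)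
    have "AE x in M. x \<in> X"
      using assms by (simp add: AE_in_set_eq_1 emeasure_eq_measure)
    then show "AE x in M. (\<Sum>y\<in>UNIV. ennreal (mixq y x G0) * indicator (- X) (snd (y, x))) = 0"
      by eventually_elim auto
  qed
  also have "\<dots> = 0" by simp
  finally have "AE z in obs_law M G0. indicator (- X) (snd z) = (0::ennreal)"
    by (subst (asm) nn_integral_0_iff_AE)
       (use assms in \<open>auto simp: sets_obs_law cong: measurable_cong_sets\<close>)
  then show ?thesis by eventually_elim (auto simp: indicator_def split: if_splits)
qed

section \<open>Weights separating distant alternatives from the true distribution\<close>

lemma qdist_le_mixq_dist:
  fixes M :: "((real^'d)^'c::finite) measure"
  assumes "prob_space M" "sets M = sets borel" "G \<in> PBorel" "G0 \<in> PBorel"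
  shows "qdist M G G0 \<le> mixq_dist M G G0"
    and "integrable M (\<lambda>x. \<Sum>j\<in>UNIV. \<bar>mixq j x G - mixq j x G0\<bar>)"
proof -
  interpret prob_space M by fact
  have [measurable]: "(\<lambda>x. mixq y x G) \<in> borel_measurable M" "(\<lambda>x. mixq y x G0) \<in> borel_measurable M" for y
    by (intro borel_measurable_mixq_cov assms)+
  have "\<bar>mixq j x G - mixq j x G0\<bar> \<le> 1" for j x
    using mixq_pos[OF assms(3), of j x] mixq_pos[OF assms(4), of j x]
      mixq_le_1[OF assms(3), of j x] mixq_le_1[OF assms(4), of j x] by linarith
  then have "integrable M (\<lambda>x. \<bar>mixq j x G - mixq j x G0\<bar>)" for j
    by (intro integrable_const_bound[where B=1]) auto
  then show int: "integrable M (\<lambda>x. \<Sum>j\<in>UNIV. \<bar>mixq j x G - mixq j x G0\<bar>)"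
    by (intro Bochner_Integration.integrable_sum)
  show "qdist M G G0 \<le> mixq_dist M G G0"
    unfolding qdist_def mixq_dist_def
  proof (rule integral_mono'[OF int])
    fix x
    show "norm (mixq_vec x G - mixq_vec x G0) \<le> (\<Sum>j\<in>UNIV. \<bar>mixq j x G - mixq j x G0\<bar>)"
      using norm_le_l1_cart[of "mixq_vec x G - mixq_vec x G0"] by (simp add: mixq_vec_def)
  qed (auto intro: sum_nonneg)
qed

text \<open>After clearing the denominator, the gap is \<open>s\<^sup>2 * (1 - 2 * s)\<close>. The
  bound controls the mean of \<open>1 / w\<close> by the first two moments of the centred test
  function.\<close>

lemma inverse_one_minus_le:
  fixes s :: real assumes "\<bar>s\<bar> \<le> 1 / 2"
  shows "1 / (1 - s) \<le> 1 + s + 2 * s\<^sup>2"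
proof -
  have "0 \<le> s\<^sup>2 * (1 - 2 * s)" using assms by (intro mult_nonneg_nonneg) auto
  also have "\<dots> = (1 + s + 2 * s\<^sup>2) * (1 - s) - 1" by (simp add: algebra_simps power2_eq_square)
  finally show ?thesis using assms by (simp add: divide_le_eq)
qed

text \<open>The weight is \<open>1 - t * (\<phi> - m)\<close> for the test function
  \<open>\<phi> = sgn (q(G') - q(G0))\<close>, whose mean exceeds \<open>m\<close> under \<open>G\<close> and falls short of it under \<open>G0\<close>.\<close>
lemma test_weight:
  fixes M :: "((real^'d)^'c::finite) measure"
  assumes M: "prob_space M" and M_sets[measurable_cong]: "sets M = sets borel"
    and G0: "G0 \<in> PBorel" and G': "G' \<in> PBorel"
    and \<epsilon>: "0 < \<epsilon>" "\<epsilon> \<le> 1" and far: "\<epsilon> < mixq_dist M G' G0"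
  shows "\<exists>w. w \<in> borel_measurable (count_space UNIV \<Otimes>\<^sub>M M) \<and> (\<forall>z. 0 < w z) \<and>
    (\<integral>\<^sup>+z. ennreal (1 / w z) \<partial>obs_law M G0) \<le> ennreal (1 - \<epsilon>\<^sup>2 / 1152) \<and>
    (\<forall>G\<in>PBorel. mixq_dist M G G' < \<epsilon> / 2 \<longrightarrow>
       (\<integral>\<^sup>+z. ennreal (mixq (fst z) (snd z) G / mixq (fst z) (snd z) G0) * ennreal (w z) \<partial>obs_law M G0)
         \<le> ennreal (1 - \<epsilon>\<^sup>2 / 1152))"
proof -
  interpret prob_space M by fact
  have mixq_meas[measurable]: "(\<lambda>z. mixq (fst z) (snd z) H) \<in> borel_measurable (count_space UNIV \<Otimes>\<^sub>M M)"
    if "H \<in> PBorel" for H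
    using that by (intro borel_measurable_mixq_choice measurable_const) auto
  have mixq_meas'[measurable]: "(\<lambda>x. mixq y x H) \<in> borel_measurable M" if "H \<in> PBorel" for y H
    by (rule borel_measurable_mixq_cov[OF that M_sets])
  note G0[measurable] G'[measurable]
  define \<phi> where "\<phi> y x = sgn (mixq y x G' - mixq y x G0)" for y and x :: "(real^'d)^'c"
  have \<phi>_abs: "\<bar>\<phi> y x\<bar> \<le> 1" for y x by (simp add: \<phi>_def abs_sgn_eq)
  have [measurable]: "(\<lambda>x. \<phi> y x) \<in> borel_measurable M" for y unfolding \<phi>_def sgn_real_def by measurable
  have \<phi>_meas[measurable]: "(\<lambda>z. \<phi> (fst z) (snd z)) \<in> borel_measurable (count_space UNIV \<Otimes>\<^sub>M M)"
    unfolding \<phi>_def sgn_real_def by measurable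
  define E where "E H = (\<integral>x. (\<Sum>y\<in>UNIV. mixq y x H * \<phi> y x) \<partial>M)" for H
  have int1: "integrable M (\<lambda>x. mixq y x H * \<phi> y x)" if "H \<in> PBorel" for y H
  proof (rule integrable_const_bound[where B=1])
    have "norm (mixq y x H * \<phi> y x) \<le> 1" for x
      unfolding norm_mult using \<phi>_abs[of y x] mixq_le_1[OF that, of y x] mixq_pos[OF that, of y x]
      by (intro mult_le_one) auto
    then show "AE x in M. norm (mixq y x H * \<phi> y x) \<le> 1" by simp
  qed (use that in measurable)
  have int: "integrable M (\<lambda>x. \<Sum>y\<in>UNIV. mixq y x H * \<phi> y x)" if "H \<in> PBorel" for H
    by (intro Bochner_Integration.integrable_sum int1 that)
  \<comment> \<open>Nonnegativity is essential here because \<open>ennreal\<close> truncates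
    negative values to 0.\<close>
  have avg: "(\<integral>\<^sup>+x. (\<Sum>y\<in>UNIV. ennreal (mixq y x H) * ennreal (a + c * \<phi> y x)) \<partial>M) = ennreal (a + c * E H)"
    if H: "H \<in> PBorel" and nonneg: "\<And>y x. 0 \<le> a + c * \<phi> y x" for H a c
  proof -
    have eq: "(\<Sum>y\<in>UNIV. mixq y x H * (a + c * \<phi> y x)) = a + c * (\<Sum>y\<in>UNIV. mixq y x H * \<phi> y x)" for x
      using sum_mixq[OF H, of x]
      by (simp add: distrib_left sum.distrib sum_distrib_left mult.left_commute flip: sum_distrib_right)
    have "(\<Sum>y\<in>UNIV. ennreal (mixq y x H) * ennreal (a + c * \<phi> y x)) =
        ennreal (a + c * (\<Sum>y\<in>UNIV. mixq y x H * \<phi> y x))" for x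
      unfolding eq[symmetric] using nonneg mixq_pos[OF H, of _ x]
      by (subst sum_ennreal[symmetric]) (auto simp: less_imp_le ennreal_mult)
    moreover have "0 \<le> a + c * (\<Sum>y\<in>UNIV. mixq y x H * \<phi> y x)" for x
      unfolding eq[symmetric] using nonneg mixq_pos[OF H, of _ x] by (auto intro!: sum_nonneg simp: less_imp_le)
    ultimately show ?thesis
      using int[OF H] by (simp add: nn_integral_eq_integral E_def prob_space)
  qed
  have E_abs: "\<bar>E G0\<bar> \<le> 1"
  proof -
    have "\<bar>\<Sum>y\<in>UNIV. mixq y x G0 * \<phi> y x\<bar> \<le> (\<Sum>y\<in>UNIV. mixq y x G0)" for x
      using mixq_pos[OF G0, of _ x] \<phi>_abs[of _ x]
      by (intro order_trans[OF sum_abs] sum_mono) (auto simp: abs_mult mult_left_le less_imp_le)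
    then have "(\<integral>x. \<bar>\<Sum>y\<in>UNIV. mixq y x G0 * \<phi> y x\<bar> \<partial>M) \<le> (\<integral>x. 1 \<partial>M)"
      by (intro integral_mono') (auto simp: sum_mixq[OF G0])
    then show ?thesis
      unfolding E_def by (intro order_trans[OF integral_abs_bound]) (simp add: prob_space)
  qed
  \<comment> \<open>A number times its sign is its absolute value, so this test function attains the
    l1 distance.\<close>
  have E_gap: "E G' - E G0 = mixq_dist M G' G0"
  proof -
    have "E G' - E G0 = (\<integral>x. (\<Sum>y\<in>UNIV. mixq y x G' * \<phi> y x) - (\<Sum>y\<in>UNIV. mixq y x G0 * \<phi> y x) \<partial>M)"
      unfolding E_def by (rule Bochner_Integration.integral_diff[symmetric]) (intro int G0 G')+
    also have "\<dots> = mixq_dist M G' G0"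
      unfolding mixq_dist_def sum_subtractf[symmetric] left_diff_distrib[symmetric] \<phi>_def
      by (simp add: abs_sgn)
    finally show ?thesis .
  qed
  have E_lip: "E G' - E G \<le> mixq_dist M G G'" if G: "G \<in> PBorel" for G
  proof -
    have "E G' - E G = (\<integral>x. (\<Sum>y\<in>UNIV. mixq y x G' * \<phi> y x) - (\<Sum>y\<in>UNIV. mixq y x G * \<phi> y x) \<partial>M)"
      unfolding E_def by (rule Bochner_Integration.integral_diff[symmetric]) (intro int G G')+
    also have "\<dots> \<le> mixq_dist M G G'"
      unfolding mixq_dist_def
    proof (rule integral_mono'[OF qdist_le_mixq_dist(2)[OF M M_sets G G']])
      fix x
      have "mixq y x G' * \<phi> y x - mixq y x G * \<phi> y x \<le> \<bar>mixq y x G - mixq y x G'\<bar>" for y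
      proof -
        have "mixq y x G' * \<phi> y x - mixq y x G * \<phi> y x \<le> \<bar>(mixq y x G' - mixq y x G) * \<phi> y x\<bar>"
          by (simp add: left_diff_distrib)
        also have "\<dots> \<le> \<bar>mixq y x G' - mixq y x G\<bar>"
          using \<phi>_abs[of y x] by (simp add: abs_mult mult_left_le)
        finally show ?thesis by (simp add: abs_minus_commute)
      qed
      then show "(\<Sum>y\<in>UNIV. mixq y x G' * \<phi> y x) - (\<Sum>y\<in>UNIV. mixq y x G * \<phi> y x) \<le> (\<Sum>y\<in>UNIV. \<bar>mixq y x G - mixq y x G'\<bar>)"
        unfolding sum_subtractf[symmetric] by (rule sum_mono)
    qed (auto intro: sum_nonneg)
    finally show ?thesis .
  qed
  \<comment> \<open>Every \<open>G\<close> in the ball has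
    \<open>E G > E G0 + \<epsilon> / 2\<close>: the centre gains more than \<open>\<epsilon>\<close>
    and the radius costs less than \<open>\<epsilon> / 2\<close>. The midpoint \<open>m\<close>
    leaves a margin of \<open>\<epsilon> / 4\<close> on both sides.\<close>
  define m where "m = E G0 + \<epsilon> / 4"
  \<comment> \<open>The minimiser of \<open>18 * t\<^sup>2 - t * (\<epsilon> / 4)\<close>, where 18
    is \<open>2 * 3\<^sup>2\<close> from the quadratic term and the bound 3 on the centred test
    function. The minimum is \<open>- \<epsilon>\<^sup>2 / 1152\<close>.\<close>
  define t where "t = \<epsilon> / 144"
  have t: "0 < t" "t \<le> 1 / 144" using \<epsilon> by (auto simp: t_def)
  have u_abs: "\<bar>\<phi> y x - m\<bar> \<le> 3" for y x
    using \<phi>_abs[of y x] E_abs \<epsilon> unfolding m_def by linarith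
  have tu_abs: "\<bar>t * (\<phi> y x - m)\<bar> \<le> 1 / 48" for y x
    using mult_mono[OF t(2) u_abs[of y x]] t(1) by (simp add: abs_mult)
  define w where "w z = 1 - t * (\<phi> (fst z) (snd z) - m)" for z
  have w_pos: "0 < w z" for z using tu_abs[of "fst z" "snd z"] unfolding w_def by linarith
  have [measurable]: "w \<in> borel_measurable (count_space UNIV \<Otimes>\<^sub>M M)" unfolding w_def by measurable
  have t_eps: "1 - t * (\<epsilon> / 4) + 18 * t\<^sup>2 = 1 - \<epsilon>\<^sup>2 / 1152" by (simp add: t_def power2_eq_square)
  have "(\<integral>\<^sup>+z. ennreal (1 / w z) \<partial>obs_law M G0) = (\<integral>\<^sup>+x. (\<Sum>y\<in>UNIV. ennreal (mixq y x G0) * ennreal (1 / w (y, x))) \<partial>M)"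
    by (rule nn_integral_obs_law[OF M M_sets G0]) measurable
  also have "\<dots> \<le> (\<integral>\<^sup>+x. (\<Sum>y\<in>UNIV. ennreal (mixq y x G0) * ennreal ((1 - t * m + 18 * t\<^sup>2) + t * \<phi> y x)) \<partial>M)"
  proof (intro nn_integral_mono sum_mono mult_left_mono ennreal_leI)
    fix x y
    have "1 / w (y, x) \<le> 1 + t * (\<phi> y x - m) + 2 * (t * (\<phi> y x - m))\<^sup>2"
      unfolding w_def using inverse_one_minus_le[of "t * (\<phi> y x - m)"] tu_abs[of y x] by simp
    moreover have "(\<phi> y x - m)\<^sup>2 \<le> 3\<^sup>2" using u_abs[of y x] by (simp only: abs_le_square_iff[symmetric])
    then have "2 * (t * (\<phi> y x - m))\<^sup>2 \<le> 18 * t\<^sup>2"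
      using mult_left_mono[of "(\<phi> y x - m)\<^sup>2" 9 "2 * t\<^sup>2"] by (simp add: power_mult_distrib)
    ultimately show "1 / w (y, x) \<le> (1 - t * m + 18 * t\<^sup>2) + t * \<phi> y x" by (simp add: right_diff_distrib)
  qed simp
  also have "\<dots> = ennreal ((1 - t * m + 18 * t\<^sup>2) + t * E G0)"
  proof (rule avg[OF G0])
    fix y x show "0 \<le> (1 - t * m + 18 * t\<^sup>2) + t * \<phi> y x"
      using tu_abs[of y x] zero_le_power2[of t] unfolding right_diff_distrib by linarith
  qed
  also have "(1 - t * m + 18 * t\<^sup>2) + t * E G0 = 1 - \<epsilon>\<^sup>2 / 1152"
    unfolding t_eps[symmetric] by (simp add: m_def algebra_simps)
  finally have inv: "(\<integral>\<^sup>+z. ennreal (1 / w z) \<partial>obs_law M G0) \<le> ennreal (1 - \<epsilon>\<^sup>2 / 1152)" .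
  have "(\<integral>\<^sup>+z. ennreal (mixq (fst z) (snd z) G / mixq (fst z) (snd z) G0) * ennreal (w z) \<partial>obs_law M G0)
         \<le> ennreal (1 - \<epsilon>\<^sup>2 / 1152)" if G[measurable]: "G \<in> PBorel" and near: "mixq_dist M G G' < \<epsilon> / 2" for G
  proof -
    have "(\<integral>\<^sup>+z. ennreal (mixq (fst z) (snd z) G / mixq (fst z) (snd z) G0) * ennreal (w z) \<partial>obs_law M G0) =
      (\<integral>\<^sup>+x. (\<Sum>y\<in>UNIV. ennreal (mixq y x G0) * (ennreal (mixq (fst (y, x)) (snd (y, x)) G / mixq (fst (y, x)) (snd (y, x)) G0) * ennreal (w (y, x)))) \<partial>M)"
      by (rule nn_integral_obs_law[OF M M_sets G0]) measurable
    \<comment> \<open>The likelihood ratio cancels the density under \<open>G0\<close>, so the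
      weight is averaged under \<open>G\<close> instead.\<close>
    also have "\<dots> = (\<integral>\<^sup>+x. (\<Sum>y\<in>UNIV. ennreal (mixq y x G) * ennreal ((1 + t * m) + (- t) * \<phi> y x)) \<partial>M)"
    proof (intro nn_integral_cong sum.cong refl)
      fix x :: "(real^'d)^'c" and y :: 'c
      have "ennreal (mixq y x G0) * ennreal (mixq y x G / mixq y x G0) = ennreal (mixq y x G)"
        using mixq_pos[OF G0, of y x] mixq_pos[OF G, of y x] by (simp flip: ennreal_mult)
      moreover have "w (y, x) = (1 + t * m) + (- t) * \<phi> y x" by (simp add: w_def right_diff_distrib)
      ultimately show "ennreal (mixq y x G0) * (ennreal (mixq (fst (y, x)) (snd (y, x)) G / mixq (fst (y, x)) (snd (y, x)) G0) * ennreal (w (y, x))) =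
          ennreal (mixq y x G) * ennreal ((1 + t * m) + (- t) * \<phi> y x)"
        by (simp add: mult.assoc[symmetric])
    qed
    also have "\<dots> = ennreal ((1 + t * m) + (- t) * E G)"
    proof (rule avg[OF G])
      fix y x show "0 \<le> (1 + t * m) + (- t) * \<phi> y x"
        using tu_abs[of y x] unfolding right_diff_distrib minus_mult_left[symmetric] by linarith
    qed
    also have "\<dots> \<le> ennreal (1 - \<epsilon>\<^sup>2 / 1152)"
    proof (rule ennreal_leI)
      have "m + \<epsilon> / 4 \<le> E G"
        using E_gap E_lip[OF G] near far unfolding m_def by linarith
      then have "t * (m + \<epsilon> / 4) \<le> t * E G" using t(1) by (intro mult_left_mono) auto
      then show "(1 + t * m) + (- t) * E G \<le> 1 - \<epsilon>\<^sup>2 / 1152"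
        using zero_le_power2[of t]
        unfolding t_eps[symmetric] distrib_left minus_mult_left[symmetric] by linarith
    qed
    finally show ?thesis .
  qed
  with inv w_pos show ?thesis by (intro exI[of _ w]) auto
qed

text \<open>The far set is covered by finitely many balls of radius \<open>\<epsilon> / 2\<close>
  centred in the set itself, and one weight handles each ball.\<close>

lemma finite_test_weights:
  fixes M :: "((real^'d)^'c::finite) measure"
  assumes M: "prob_space M" and M_sets: "sets M = sets borel" and G0: "G0 \<in> PBorel"
    and \<epsilon>: "0 < \<epsilon>" "\<epsilon> \<le> 1"
  shows "\<exists>W. finite W \<and>
    (\<forall>w\<in>W. w \<in> borel_measurable (count_space UNIV \<Otimes>\<^sub>M M) \<and> (\<forall>z. 0 < w z) \<and>
       (\<integral>\<^sup>+z. ennreal (1 / w z) \<partial>obs_law M G0) \<le> ennreal (1 - \<epsilon>\<^sup>2 / 1152)) \<and>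
    (\<forall>G\<in>PBorel. \<epsilon> < qdist M G G0 \<longrightarrow> (\<exists>w\<in>W.
       (\<integral>\<^sup>+z. ennreal (mixq (fst z) (snd z) G / mixq (fst z) (snd z) G0) * ennreal (w z) \<partial>obs_law M G0)
         \<le> ennreal (1 - \<epsilon>\<^sup>2 / 1152)))"
proof -
  define A where "A = {G \<in> PBorel. \<epsilon> < mixq_dist M G G0}"
  obtain F where F: "F \<subseteq> A" "finite F" "\<And>G. G \<in> A \<Longrightarrow> \<exists>G'\<in>F. mixq_dist M G G' < \<epsilon> / 2"
    using mixq_dist_finite_net[OF M M_sets, of A "\<epsilon> / 2"] \<epsilon> unfolding A_def by auto
  have "\<forall>G'\<in>F. \<exists>w. w \<in> borel_measurable (count_space UNIV \<Otimes>\<^sub>M M) \<and> (\<forall>z. 0 < w z) \<and>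
    (\<integral>\<^sup>+z. ennreal (1 / w z) \<partial>obs_law M G0) \<le> ennreal (1 - \<epsilon>\<^sup>2 / 1152) \<and>
    (\<forall>G\<in>PBorel. mixq_dist M G G' < \<epsilon> / 2 \<longrightarrow>
       (\<integral>\<^sup>+z. ennreal (mixq (fst z) (snd z) G / mixq (fst z) (snd z) G0) * ennreal (w z) \<partial>obs_law M G0)
         \<le> ennreal (1 - \<epsilon>\<^sup>2 / 1152))"
    using F(1) by (intro ballI test_weight[OF M M_sets G0 _ \<epsilon>]) (auto simp: A_def)
  then obtain wt where wt: "\<forall>G'\<in>F. wt G' \<in> borel_measurable (count_space UNIV \<Otimes>\<^sub>M M) \<and> (\<forall>z. 0 < wt G' z) \<and>
    (\<integral>\<^sup>+z. ennreal (1 / wt G' z) \<partial>obs_law M G0) \<le> ennreal (1 - \<epsilon>\<^sup>2 / 1152) \<and>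
    (\<forall>G\<in>PBorel. mixq_dist M G G' < \<epsilon> / 2 \<longrightarrow>
       (\<integral>\<^sup>+z. ennreal (mixq (fst z) (snd z) G / mixq (fst z) (snd z) G0) * ennreal (wt G' z) \<partial>obs_law M G0)
         \<le> ennreal (1 - \<epsilon>\<^sup>2 / 1152))"
    by (rule bchoice[THEN exE])
  show ?thesis
  proof (intro exI[of _ "wt ` F"] conjI ballI impI)
    fix G assume G: "G \<in> PBorel" "\<epsilon> < qdist M G G0"
    then have "G \<in> A" using qdist_le_mixq_dist(1)[OF M M_sets G(1) G0] by (simp add: A_def)
    then obtain G' where "G' \<in> F" "mixq_dist M G G' < \<epsilon> / 2" using F(3) by blast
    then show "\<exists>w\<in>wt ` F.
       (\<integral>\<^sup>+z. ennreal (mixq (fst z) (snd z) G / mixq (fst z) (snd z) G0) * ennreal (w z) \<partial>obs_law M G0)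
         \<le> ennreal (1 - \<epsilon>\<^sup>2 / 1152)"
      using wt G(1) by blast
  qed (use F(2) wt in auto)
qed

subsection \<open>Posterior consistency\<close>

lemma lik_ratio_nonneg:
  "G \<in> PBorel \<Longrightarrow> G0 \<in> PBorel \<Longrightarrow> 0 \<le> lik_ratio G0 n \<omega> G"
  by (auto simp: lik_ratio_def less_imp_le[OF mixq_pos] intro!: prod_nonneg divide_nonneg_nonneg)

text \<open>For fixed data the numerators are at most 1 and the denominators do not depend on
  \<open>G\<close>, so the product is bounded. This guards the posterior against the default value 0
  of a Bochner integral that does not exist.\<close>

lemma integrable_lik_ratio:
  fixes \<omega> :: "nat \<Rightarrow> 'c::finite \<times> ((real^'d)^'c)"
  assumes "prob_space Prior" and Pi_sets[measurable_cong]: "sets Prior = sets (prob_algebra borel)" and G0: "G0 \<in> PBorel"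
  shows "integrable Prior (lik_ratio G0 n \<omega>)"
proof -
  interpret prob_space Prior by fact
  have space: "space Prior = PBorel" by (rule sets_eq_imp_space_eq[OF Pi_sets])
  have [measurable]: "(\<lambda>G. mixq j x G) \<in> borel_measurable Prior" for j :: 'c and x
    by (intro borel_measurable_mixq measurable_const) (auto cong: measurable_cong_sets simp: Pi_sets)
  have "norm (lik_ratio G0 n \<omega> G) \<le> (\<Prod>i<n. 1 / mixq (fst (\<omega> i)) (snd (\<omega> i)) G0)" if "G \<in> PBorel" for G
    using lik_ratio_nonneg[OF that G0, of n \<omega>]
    by (auto simp: lik_ratio_def less_imp_le[OF mixq_pos] mixq_le_1[OF that] that G0
        intro!: prod_mono divide_nonneg_nonneg divide_right_mono)
  then show ?thesis
    by (intro integrable_const_bound[where B="\<Prod>i<n. 1 / mixq (fst (\<omega> i)) (snd (\<omega> i)) G0"])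
       (auto simp: space lik_ratio_def[abs_def])
qed

lemma lik_ratio_integral_lower_bound:
  fixes \<omega> :: "nat \<Rightarrow> 'c::finite \<times> ((real^'d)^'c)"
  assumes "prob_space Prior" and Pi_sets: "sets Prior = sets (prob_algebra borel)" and G0: "G0 \<in> PBorel"
    and U: "U \<in> sets Prior" and "0 \<le> \<kappa>"
    and ratio: "\<And>G i. G \<in> U \<Longrightarrow> \<kappa> \<le> mixq (fst (\<omega> i)) (snd (\<omega> i)) G / mixq (fst (\<omega> i)) (snd (\<omega> i)) G0"
  shows "measure Prior U * \<kappa> ^ n \<le> (\<integral>G. lik_ratio G0 n \<omega> G \<partial>Prior)"
proof -
  interpret prob_space Prior by fact
  have space: "space Prior = PBorel" by (rule sets_eq_imp_space_eq[OF Pi_sets])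
  have "\<kappa> ^ n \<le> lik_ratio G0 n \<omega> G" if "G \<in> U" for G
  proof -
    have "(\<Prod>i<n. \<kappa>) \<le> lik_ratio G0 n \<omega> G"
      unfolding lik_ratio_def using ratio[OF that] \<open>0 \<le> \<kappa>\<close> by (intro prod_mono) auto
    then show ?thesis by simp
  qed
  then have "(\<integral>G. indicator U G * \<kappa> ^ n \<partial>Prior) \<le> (\<integral>G. lik_ratio G0 n \<omega> G \<partial>Prior)"
    using lik_ratio_nonneg[OF _ G0] space
    by (intro integral_mono'[OF integrable_lik_ratio[OF assms(1-3)]]) (auto simp: indicator_def)
  then show ?thesis using U by simp
qed

text \<open>A union bound over the cover. \<open>A\<close> may be any set:
  \<open>integral_mono'\<close> asks for integrability of the nonnegative majorant, and a
  nonintegrable left side has integral 0.\<close>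

lemma restricted_lik_ratio_integral_le_sum:
  fixes \<omega> :: "nat \<Rightarrow> 'c::finite \<times> ((real^'d)^'c)"
  assumes "prob_space Prior" and Pi_sets: "sets Prior = sets (prob_algebra borel)" and G0: "G0 \<in> PBorel"
    and "finite W" and B: "\<And>w. w \<in> W \<Longrightarrow> B w \<in> sets Prior" and cover: "A \<subseteq> (\<Union>w\<in>W. B w)" and "0 \<le> c"
    and bound: "\<And>w. w \<in> W \<Longrightarrow> (\<integral>\<^sup>+G. indicator (B w) G *
        (\<Prod>i<n. ennreal (mixq (fst (\<omega> i)) (snd (\<omega> i)) G / mixq (fst (\<omega> i)) (snd (\<omega> i)) G0)) \<partial>Prior) \<le> ennreal c"
  shows "(\<integral>G. indicator A G * lik_ratio G0 n \<omega> G \<partial>Prior) \<le> real (card W) * c"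
proof -
  interpret prob_space Prior by fact
  have space: "space Prior = PBorel" by (rule sets_eq_imp_space_eq[OF Pi_sets])
  have int: "integrable Prior (\<lambda>G. indicator (B w) G * lik_ratio G0 n \<omega> G)" if "w \<in> W" for w
    using integrable_mult_indicator[OF B[OF that] integrable_lik_ratio[OF assms(1-3)]] by simp
  have "(\<integral>G. indicator A G * lik_ratio G0 n \<omega> G \<partial>Prior) \<le> (\<integral>G. (\<Sum>w\<in>W. indicator (B w) G * lik_ratio G0 n \<omega> G) \<partial>Prior)"
  proof (rule integral_mono')
    fix G assume "G \<in> space Prior"
    then have L: "0 \<le> lik_ratio G0 n \<omega> G" using lik_ratio_nonneg[OF _ G0] space by blast
    then show nonneg: "0 \<le> (\<Sum>w\<in>W. indicator (B w) G * lik_ratio G0 n \<omega> G)" by (intro sum_nonneg) auto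
    show "indicator A G * lik_ratio G0 n \<omega> G \<le> (\<Sum>w\<in>W. indicator (B w) G * lik_ratio G0 n \<omega> G)"
    proof (cases "G \<in> A")
      case True
      with cover obtain w where w: "w \<in> W" "G \<in> B w" by blast
      have "indicator (B w) G * lik_ratio G0 n \<omega> G \<le> (\<Sum>w\<in>W. indicator (B w) G * lik_ratio G0 n \<omega> G)"
        using w(1) L \<open>finite W\<close> by (intro member_le_sum) auto
      then show ?thesis using True w(2) by simp
    qed (use nonneg in simp)
  qed (intro Bochner_Integration.integrable_sum int)
  also have "\<dots> = (\<Sum>w\<in>W. \<integral>G. indicator (B w) G * lik_ratio G0 n \<omega> G \<partial>Prior)"
    by (intro Bochner_Integration.integral_sum int)
  also have "\<dots> \<le> (\<Sum>w\<in>W. c)"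
  proof (rule sum_mono)
    fix w assume w: "w \<in> W"
    have "ennreal (\<integral>G. indicator (B w) G * lik_ratio G0 n \<omega> G \<partial>Prior) =
        (\<integral>\<^sup>+G. ennreal (indicator (B w) G * lik_ratio G0 n \<omega> G) \<partial>Prior)"
      using lik_ratio_nonneg[OF _ G0] space
      by (intro nn_integral_eq_integral[symmetric] int w AE_I2 mult_nonneg_nonneg) auto
    also have "\<dots> = (\<integral>\<^sup>+G. indicator (B w) G *
        (\<Prod>i<n. ennreal (mixq (fst (\<omega> i)) (snd (\<omega> i)) G / mixq (fst (\<omega> i)) (snd (\<omega> i)) G0)) \<partial>Prior)"
      using space
      by (intro nn_integral_cong)
         (auto simp: lik_ratio_def indicator_def prod_ennreal less_imp_le[OF mixq_pos] G0)
    also have "\<dots> \<le> ennreal c" by (rule bound[OF w])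
    finally show "(\<integral>G. indicator (B w) G * lik_ratio G0 n \<omega> G \<partial>Prior) \<le> c"
      using \<open>0 \<le> c\<close> by simp
  qed
  finally show ?thesis by simp
qed

theorem theorem1:
  fixes X :: "((real^'d)^'c::finite) set"
    and M :: "((real^'d)^'c) measure"
    and G0 :: "(real^'d) measure"
    and Prior :: "(real^'d) measure measure"
  assumes J2: "CARD('c) \<ge> 2"
    and X_compact: "compact X"
    and M_borel: "sets M = sets borel"
    and M_prob: "prob_space M"
    and M_on_X: "emeasure M X = 1"
    and G0_P: "G0 \<in> PBorel"
    and Pi_prob: "prob_space Prior"
    and Pi_sets: "sets Prior = sets (prob_algebra (borel :: (real^'d) measure))"
    and supp: "in_weak_support Prior G0"
    and pos: "\<forall>j. \<forall>x\<in>X. mixq j x G0 > 0"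
    and moment: "(\<integral>\<^sup>+ \<beta>. ennreal (norm \<beta>) \<partial>(prior_predictive Prior)) < \<infinity>"
  shows "\<forall>\<epsilon>>0. AE \<omega> in data_law M G0.
           (\<lambda>n. posterior Prior G0 n \<omega> {G \<in> PBorel. qdist M G G0 > \<epsilon>}) \<longlonglongrightarrow> 0"
proof (intro allI impI)
  fix \<epsilon> :: real assume "\<epsilon> > 0"
  \<comment> \<open>The weights are built for radii at most 1; lowering the radius only enlarges the
    set of alternatives to be excluded.\<close>
  define e where "e = min \<epsilon> 1"
  have e: "0 < e" "e \<le> 1" "e \<le> \<epsilon>" using \<open>\<epsilon> > 0\<close> by (auto simp: e_def)
  define \<rho> where "\<rho> = 1 - e\<^sup>2 / 1152"
  have "0 < e\<^sup>2" "e\<^sup>2 \<le> 1" using e by (auto simp: power_le_one)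
  then have \<rho>: "0 < \<rho>" "\<rho> < 1" by (auto simp: \<rho>_def)
  \<comment> \<open>The midpoint of \<rho> and 1, so that the denominator decays strictly more
    slowly than the numerator.\<close>
  define \<kappa> where "\<kappa> = (1 + \<rho>) / 2"
  have \<kappa>: "0 < \<kappa>" "\<kappa> < 1" "\<rho> < \<kappa>" using \<rho> by (auto simp: \<kappa>_def)
  define P where "P = obs_law M G0"
  have P_prob: "prob_space P" unfolding P_def by (rule prob_space_obs_law[OF M_prob M_borel G0_P])
  have P_sets: "sets P = sets (count_space UNIV \<Otimes>\<^sub>M M)"
    unfolding P_def by (rule sets_obs_law)
  interpret Prior: prob_space Prior by fact
  have space: "space Prior = PBorel" by (rule sets_eq_imp_space_eq[OF Pi_sets])
  define r where "r z G = ennreal (mixq (fst z) (snd z) G / mixq (fst z) (snd z) G0)"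
    for z :: "'c \<times> ((real^'d)^'c)" and G
  have r_meas: "(\<lambda>(z, G). r z G) \<in> borel_measurable (P \<Otimes>\<^sub>M Prior)"
  proof -
    note P_sets[measurable_cong] M_borel[measurable_cong] Pi_sets[measurable_cong]
    have "(\<lambda>p. mixq (fst (fst p)) (snd (fst p)) (snd p)) \<in> borel_measurable (P \<Otimes>\<^sub>M Prior)"
      "(\<lambda>p. mixq (fst (fst p)) (snd (fst p)) G0) \<in> borel_measurable (P \<Otimes>\<^sub>M Prior)"
      by (intro borel_measurable_mixq_choice measurable_const G0_P; measurable)+
    then show ?thesis unfolding r_def case_prod_unfold by measurable
  qed
  obtain W where W1: "finite W"
    and W_ball: "\<forall>w\<in>W. w \<in> borel_measurable (count_space UNIV \<Otimes>\<^sub>M M) \<and> (\<forall>z. 0 < w z) \<and>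
       (\<integral>\<^sup>+z. ennreal (1 / w z) \<partial>P) \<le> ennreal \<rho>"
    and W5: "\<forall>G\<in>PBorel. e < qdist M G G0 \<longrightarrow> (\<exists>w\<in>W. (\<integral>\<^sup>+z. r z G * ennreal (w z) \<partial>P) \<le> ennreal \<rho>)"
    using finite_test_weights[OF M_prob M_borel G0_P e(1,2)]
    unfolding P_def[symmetric] \<rho>_def[symmetric] r_def[symmetric] by (elim exE conjE) (rule that; assumption)
  note W = W1 W_ball[rule_format, THEN conjunct1] W_ball[rule_format, THEN conjunct2, THEN conjunct1, rule_format]
    W_ball[rule_format, THEN conjunct2, THEN conjunct2] W5[rule_format]
  define B where "B w = {G \<in> space Prior. (\<integral>\<^sup>+z. r z G * ennreal (w z) \<partial>P) \<le> ennreal \<rho>}" for w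
  have B_sets: "B w \<in> sets Prior" if "w \<in> W" for w
  proof -
    interpret P: prob_space P by fact
    have [measurable]: "w \<in> borel_measurable P"
      using W(2)[OF that] by (simp cong: measurable_cong_sets add: P_sets)
    have [measurable]: "(\<lambda>(G, z). r z G) \<in> borel_measurable (Prior \<Otimes>\<^sub>M P)"
      using measurable_compose[OF measurable_pair_swap' r_meas] by (simp add: case_prod_unfold)
    show ?thesis unfolding B_def by measurable
  qed
  obtain U where U: "openin weak_topology U" "G0 \<in> U"
    and ratio: "\<And>G j x. G \<in> U \<Longrightarrow> x \<in> X \<Longrightarrow> \<kappa> \<le> mixq j x G / mixq j x G0"
    using weak_neighbourhood_mixq_ratio[OF X_compact G0_P \<kappa>(2)] by blast
  then have U_pos: "emeasure Prior U > 0" using supp by (auto simp: in_weak_support_def)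
  \<comment> \<open>\<open>emeasure\<close> is 0 outside the sigma-algebra, so positive prior mass
    already shows that the weakly open set is measurable.\<close>
  then have U_sets: "U \<in> sets Prior" using emeasure_notin_sets by fastforce
  have U_measure: "measure Prior U > 0" using U_pos by (simp add: Prior.emeasure_eq_measure)
  have "AE \<omega> in data_law M G0. \<forall>w\<in>W. \<forall>\<^sub>F n in sequentially.
      (\<integral>\<^sup>+G. indicator (B w) G * (\<Prod>i<n. r (\<omega> i) G) \<partial>Prior) \<le> ennreal (\<rho> ^ n)"
    unfolding data_law_def P_def[symmetric] B_def
    using W(1-4) \<rho> r_meas P_prob Pi_prob
    by (intro AE_finite_allI AE_eventually_integrated_lik_le_power)
       (auto cong: measurable_cong_sets simp: P_sets)
  moreover have "AE \<omega> in data_law M G0. \<forall>i. snd (\<omega> i) \<in> X"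
    unfolding data_law_def P_def[symmetric] AE_all_countable
  proof
    fix i
    have "AE z in P. snd z \<in> X"
      unfolding P_def using X_compact M_borel
      by (intro AE_obs_law_covariate M_prob M_borel G0_P M_on_X) (auto dest: borel_compact)
    then show "AE \<omega> in (\<Pi>\<^sub>M i\<in>UNIV. P). snd (\<omega> i) \<in> X"
      by (intro AE_PiM_component[where P="\<lambda>z. snd z \<in> X"] P_prob) auto
  qed
  ultimately show "AE \<omega> in data_law M G0.
      (\<lambda>n. posterior Prior G0 n \<omega> {G \<in> PBorel. qdist M G G0 > \<epsilon>}) \<longlonglongrightarrow> 0"
  proof eventually_elim
    case (elim \<omega>)
    let ?A = "{G \<in> PBorel. qdist M G G0 > \<epsilon>}"
    have cover: "?A \<subseteq> (\<Union>w\<in>W. B w)"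
      using W(5) e(3) by (force simp: B_def space)
    have den: "measure Prior U * \<kappa> ^ n \<le> (\<integral>G. lik_ratio G0 n \<omega> G \<partial>Prior)" for n
      using elim(2) ratio \<kappa>(1)
      by (intro lik_ratio_integral_lower_bound Pi_prob Pi_sets G0_P U_sets) auto
    have den_pos: "0 < measure Prior U * \<kappa> ^ n" for n using U_measure \<kappa>(1) by simp
    \<comment> \<open>Finiteness of \<open>W\<close> gives a common threshold in \<open>n\<close>
      for all weights.\<close>
    have "\<forall>\<^sub>F n in sequentially. \<forall>w\<in>W. (\<integral>\<^sup>+G. indicator (B w) G * (\<Prod>i<n. r (\<omega> i) G) \<partial>Prior) \<le> ennreal (\<rho> ^ n)"
      using elim(1) W(1) by (simp add: eventually_ball_finite_distrib)
    then have upper: "\<forall>\<^sub>F n in sequentially. posterior Prior G0 n \<omega> ?A \<le> real (card W) / measure Prior U * (\<rho> / \<kappa>) ^ n"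
    proof eventually_elim
      case (elim n)
      have "(\<integral>G. indicator ?A G * lik_ratio G0 n \<omega> G \<partial>Prior) \<le> real (card W) * \<rho> ^ n"
        using elim \<rho>(1) unfolding r_def
        by (intro restricted_lik_ratio_integral_le_sum[OF Pi_prob Pi_sets G0_P W(1) B_sets cover]) auto
      then have "posterior Prior G0 n \<omega> ?A \<le> (real (card W) * \<rho> ^ n) / (measure Prior U * \<kappa> ^ n)"
        unfolding posterior_def using den[of n] den_pos[of n] \<rho>(1)
        by (intro frac_le) auto
      then show ?case by (simp add: power_divide)
    qed
    have lower: "0 \<le> posterior Prior G0 n \<omega> ?A" for n
      unfolding posterior_def using lik_ratio_nonneg[OF _ G0_P] space
      by (intro divide_nonneg_nonneg integral_nonneg_AE AE_I2 mult_nonneg_nonneg) auto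
    have "(\<lambda>n. real (card W) / measure Prior U * (\<rho> / \<kappa>) ^ n) \<longlonglongrightarrow> real (card W) / measure Prior U * 0"
      using \<rho> \<kappa> by (intro tendsto_intros LIMSEQ_power_zero) auto
    then have "(\<lambda>n. real (card W) / measure Prior U * (\<rho> / \<kappa>) ^ n) \<longlonglongrightarrow> 0" by simp
    then show ?case
      by (intro tendsto_sandwich[OF _ upper tendsto_const]) (auto simp: lower)
  qed
qed

end
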